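(* With the Aztec diamond notation of the context, let $D=\begin{pmatrix}C(1)^B & C(a)^B\end{pmatrix}$ (rows $F$, columns $B\sqcup B$), and let $v\in\mathbb{C}^F$ be a nonzero vector such that $D^Tv=0$. Writing $v_{k,j}$ for the entry of $v$ at the edge $e_{k,j}$ (which carries the weight $c_{k,j}$), $0\le j\le k$, $$Y(A_k,a)=\frac{\sum_{j=0}^{k}c_{k,j}v_{k,j}}{\sum_{j=0}^{k}v_{k,j}}.$$
   Context: Fix $k\geq1$. Let $G^\bullet$ be the planar graph with vertices $b_r$, $\tilde b$ and $b_{i,j}$ ($0\le i\le k-1$, $0\le j\le k$), drawn with $b_{i,j}$ at $(i+1,j)$, $b_r$ to the left and $\tilde b$ to the right of everything. Its edges are the horizontal edges $e_{i,j}$ ($0\le i,j\le k$) joining $b_{i-1,j}$ and $b_{i,j}$, with $b_{-1,j}:=b_r$, $b_{k,j}:=\tilde b$, and the vertical edges $g_{i,j}$ ($0\le i,j\le k-1$) joining $b_{i,j}$ and $b_{i,j+1}$. Let $F$ be the set of edges of $G^\bullet$, with weights $a$: $c_{i,j}$ on $e_{i,j}$, $d_{i,j}$ on $g_{i,j}$. Let $B=\{b_{i,j}\}$ and $W$ the set of bounded faces of $G^\bullet$. The Aztec diamond $A_k$ is the bipartite planar graph on $W\sqcup B$ with $w\sim b$ iff $b$ lies on $\partial w$; $f(w,b)\in F$ (resp. $f(b,w)$) is the edge of $\partial w$ incident to $b$ traversed just before (resp. after) $b$ in a counterclockwise traversal of $\partial w$. A Kasteleyn orientation of $A_k$ is a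 skew-symmetric $\varphi$ from directed edges to $\{\pm1\}$ with $\prod_{wb\in\partial f}\varphi_{(w,b)}=(-1)^{\ell+1}$ for every bounded face of $A_k$ of degree $2\ell$; $Z(A_k,a,\varphi)=\sum_{\mathsf M}\prod_{wb\in\mathsf M}\varphi_{(w,b)}(a_{f(w,b)}-a_{f(b,w)})$ over perfect matchings of $A_k$; $Y(A_k,a)=\bigl(\prod_{f\in F}a_f\bigr)\frac{Z(A_k,a^{-1},\varphi)}{Z(A_k,a,\varphi)}$, independent of $\varphi$. $C(1)$ has rows $F$ and columns indexed by black vertices, with $C(1)_{\epsilon,b}=+1$ if $b$ is the right endpoint of horizontal $\epsilon$ or the upper endpoint of vertical $\epsilon$, $-1$ if $b$ is its left or lower endpoint, $0$ otherwise; $C(a)_{\epsilon,b}=a_\epsilon C(1)_{\epsilon,b}$; superscript $B$ denotes restriction to columns in $B$. *)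

theory Defs
  imports Complex_Main
begin

text \<open>
  In the planar graph \<open>G\<^sup>\<bullet>\<close>, \<open>Broot\<close> is $b_r$, \<open>Btilde\<close> is $\tilde b$ and \<open>Bin i j\<close> is $b_{i,j}$; \<open>Hor i j\<close> is $e_{i,j}$ and
  \<open>Ver i j\<close> is $g_{i,j}$.
\<close>

datatype bvertex = Broot | Btilde | Bin nat nat

datatype bedge = Hor nat nat | Ver nat nat

text \<open>The first index is the abscissa: \<open>bpt k x j\<close> is $b_{x-1,j}$, including the conventions
  $b_{-1,j} = b_r$ and $b_{k,j} = \tilde b$.\<close>

definition bpt :: "nat \<Rightarrow> nat \<Rightarrow> nat \<Rightarrow> bvertex" where
  "bpt k x j = (if x = 0 then Broot else if x = k + 1 then Btilde else Bin (x - 1) j)"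

definition edges :: "nat \<Rightarrow> bedge set" where
  "edges k = {Hor i j | i j. i \<le> k \<and> j \<le> k} \<union> {Ver i j | i j. i < k \<and> j < k}"

definition inner_blacks :: "nat \<Rightarrow> bvertex set" where
  "inner_blacks k = {Bin i j | i j. i < k \<and> j \<le> k}"

text \<open>Left endpoint of a horizontal edge, lower endpoint of a vertical one.\<close>

fun tail_of :: "nat \<Rightarrow> bedge \<Rightarrow> bvertex" where
  "tail_of k (Hor i j) = bpt k i j"
| "tail_of k (Ver i j) = Bin i j"

text \<open>Right endpoint of a horizontal edge, upper endpoint of a vertical one.\<close>

fun head_of :: "nat \<Rightarrow> bedge \<Rightarrow> bvertex" where
  "head_of k (Hor i j) = bpt k (i + 1) j"
| "head_of k (Ver i j) = Bin i (j + 1)"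

text \<open>
  \<open>Face i j\<close> is the bounded face of \<open>G\<^sup>\<bullet>\<close> lying between $e_{i,j}$ and $e_{i,j+1}$. Its boundary is
  given as a closed counterclockwise walk, starting with $e_{i,j}$; each vertex is paired with the
  edge traversed just after it. The faces with \<open>i = 0\<close> or \<open>i = k\<close> are triangles with
  apex $b_r$ or $\tilde b$, all others are quadrilaterals.
\<close>

datatype face = Face nat nat

definition faces :: "nat \<Rightarrow> face set" where
  "faces k = {Face i j | i j. i \<le> k \<and> j < k}"

fun boundary :: "nat \<Rightarrow> face \<Rightarrow> (bvertex \<times> bedge) list" where
  "boundary k (Face i j) =
     [(bpt k i j, Hor i j)]
     @ (if i < k then [(bpt k (i + 1) j, Ver i j)] else [])
     @ [(bpt k (i + 1) (j + 1), Hor i (j + 1))]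
     @ (if 0 < i then [(bpt k i (j + 1), Ver (i - 1) j)] else [])"

definition next_edge :: "nat \<Rightarrow> face \<Rightarrow> bvertex \<Rightarrow> bedge" where
  "next_edge k w b = the (map_of (boundary k w) b)"

definition prev_edge :: "nat \<Rightarrow> face \<Rightarrow> bvertex \<Rightarrow> bedge" where
  "prev_edge k w b =
     the (map_of (zip (rotate1 (map fst (boundary k w))) (map snd (boundary k w))) b)"

lemma boundary_closed_walk:
  assumes "w \<in> faces k"
  shows "distinct (map fst (boundary k w))"
    and "distinct (map snd (boundary k w))"
    and "snd ` set (boundary k w) \<subseteq> edges k"
    and "\<forall>((b, e), b') \<in> set (zip (boundary k w) (rotate1 (map fst (boundary k w)))).
           {b, b'} = {tail_of k e, head_of k e}"
proof -
  obtain i j where w: "w = Face i j" "i \<le> k" "j < k"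
    using assms by (auto simp: faces_def)
  consider "i = 0" "i < k" | "0 < i" "i < k" | "0 < i" "i = k"
    using w by linarith
  note cs = this
  show "distinct (map fst (boundary k w))"
    using cs by cases (use w in \<open>auto simp: bpt_def\<close>)
  show "distinct (map snd (boundary k w))"
    using cs by cases (use w in \<open>auto simp: bpt_def\<close>)
  show "snd ` set (boundary k w) \<subseteq> edges k"
    using cs by cases (use w in \<open>auto simp: edges_def\<close>)
  show "\<forall>((b, e), b') \<in> set (zip (boundary k w) (rotate1 (map fst (boundary k w)))).
           {b, b'} = {tail_of k e, head_of k e}"
    using cs by cases (use w in \<open>auto simp: bpt_def\<close>)
qed

lemma card_edges: "card (edges k) = (k + 1)\<^sup>2 + k\<^sup>2"
proof -
  have e: "edges k = (\<lambda>(i, j). Hor i j) ` ({..k} \<times> {..k}) \<union> (\<lambda>(i, j). Ver i j) ` ({..<k} \<times> {..<k})"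
    by (auto simp: edges_def)
  have "card ((\<lambda>(i, j). Hor i j) ` ({..k} \<times> {..k})) = (k + 1) * (k + 1)"
    by (subst card_image) (auto simp: inj_on_def card_cartesian_product)
  moreover have "card ((\<lambda>(i, j). Ver i j) ` ({..<k} \<times> {..<k})) = k * k"
    by (subst card_image) (auto simp: inj_on_def card_cartesian_product)
  ultimately show ?thesis
    unfolding e by (subst card_Un_disjoint) (auto simp: power2_eq_square)
qed

lemma card_inner_blacks: "card (inner_blacks k) = k * (k + 1)"
proof -
  have "inner_blacks k = (\<lambda>(i, j). Bin i j) ` ({..<k} \<times> {..k})"
    by (auto simp: inner_blacks_def)
  then show ?thesis
    by (simp, subst card_image) (auto simp: inj_on_def card_cartesian_product)
qed

lemma card_faces: "card (faces k) = (k + 1) * k"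
proof -
  have "faces k = (\<lambda>(i, j). Face i j) ` ({..k} \<times> {..<k})"
    by (auto simp: faces_def)
  then show ?thesis
    by (simp, subst card_image) (auto simp: inj_on_def card_cartesian_product)
qed

text \<open>Euler's formula, confirming that no bounded face is missing.\<close>

lemma euler_graph: "(card (inner_blacks k) + 2) + (card (faces k) + 1) = card (edges k) + 2"
  by (simp add: card_edges card_inner_blacks card_faces power2_eq_square)

definition aztec_edges :: "nat \<Rightarrow> (face \<times> bvertex) set" where
  "aztec_edges k =
     {(w, b). w \<in> faces k \<and> b \<in> inner_blacks k \<and> b \<in> fst ` set (boundary k w)}"

definition perfect_matchings :: "nat \<Rightarrow> (face \<times> bvertex) set set" where
  "perfect_matchings k =
     {M. M \<subseteq> aztec_edges k \<and> (\<forall>w \<in> faces k. \<exists>!b. (w, b) \<in> M)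
         \<and> (\<forall>b \<in> inner_blacks k. \<exists>!w. (w, b) \<in> M)}"

text \<open>The vertices of \<open>A\<^sub>k\<close> are \<open>Inl w\<close> (white) and \<open>Inr b\<close> (black).\<close>

type_synonym avertex = "face + bvertex"

text \<open>
  The bounded faces of \<open>A\<^sub>k\<close>, as counterclockwise cycles of vertices, bottom vertex first. Each of
  them surrounds one edge of \<open>G\<^sup>\<bullet>\<close> having both ends among the $b_{i,j}$ and a bounded face on both
  sides; all the other edges of \<open>G\<^sup>\<bullet>\<close> lie in the outer face of \<open>A\<^sub>k\<close>.
\<close>

definition aztec_faces :: "nat \<Rightarrow> avertex list set" where
  "aztec_faces k =
     {[Inr (Bin i j), Inl (Face (i + 1) j), Inr (Bin i (j + 1)), Inl (Face i j)]
        | i j. i < k \<and> j < k}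
   \<union> {[Inl (Face i (j - 1)), Inr (Bin i j), Inl (Face i j), Inr (Bin (i - 1) j)]
        | i j. 0 < i \<and> i < k \<and> 0 < j \<and> j < k}"

definition cycle_edges :: "avertex list \<Rightarrow> (face \<times> bvertex) set" where
  "cycle_edges f =
     {(w, b). (Inl w, Inr b) \<in> set (zip f (rotate1 f)) \<or> (Inr b, Inl w) \<in> set (zip f (rotate1 f))}"

definition kasteleyn_orientation :: "nat \<Rightarrow> (avertex \<times> avertex \<Rightarrow> int) \<Rightarrow> bool" where
  "kasteleyn_orientation k \<phi> \<longleftrightarrow>
     (\<forall>(w, b) \<in> aztec_edges k.
        \<phi> (Inl w, Inr b) \<in> {1, -1} \<and> \<phi> (Inr b, Inl w) = - \<phi> (Inl w, Inr b))
   \<and> (\<forall>f \<in> aztec_faces k. \<forall>l. length f = 2 * l \<longrightarrow>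
        (\<Prod>(w, b) \<in> cycle_edges f. \<phi> (Inl w, Inr b)) = (-1) ^ (l + 1))"

definition partition_function ::
  "nat \<Rightarrow> (bedge \<Rightarrow> complex) \<Rightarrow> (avertex \<times> avertex \<Rightarrow> int) \<Rightarrow> complex" where
  "partition_function k a \<phi> =
     (\<Sum>M \<in> perfect_matchings k. \<Prod>(w, b) \<in> M.
        of_int (\<phi> (Inl w, Inr b)) * (a (prev_edge k w b) - a (next_edge k w b)))"

definition ratio_function ::
  "nat \<Rightarrow> (bedge \<Rightarrow> complex) \<Rightarrow> (avertex \<times> avertex \<Rightarrow> int) \<Rightarrow> complex" where
  "ratio_function k a \<phi> =
     (\<Prod>f \<in> edges k. a f)
       * (partition_function k (\<lambda>f. inverse (a f)) \<phi> / partition_function k a \<phi>)"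

lemma cycle_edges_aztec_faces: "f \<in> aztec_faces k \<Longrightarrow> cycle_edges f \<subseteq> aztec_edges k"
  by (auto simp: aztec_faces_def cycle_edges_def aztec_edges_def faces_def inner_blacks_def bpt_def)

lemma aztec_edges_subset: "aztec_edges k \<subseteq> faces k \<times> inner_blacks k"
  by (auto simp: aztec_edges_def)

lemma card_aztec_edges: "card (aztec_edges k) = 4 * k\<^sup>2"
proof -
  define S where "S = {..<k} \<times> {..<k}"
  define A where "A = (\<lambda>(i, j). (Face i j, Bin i j)) ` S"
  define B where "B = (\<lambda>(i, j). (Face i j, Bin i (j + 1))) ` S"
  define C where "C = (\<lambda>(i, j). (Face (i + 1) j, Bin i j)) ` S"
  define D where "D = (\<lambda>(i, j). (Face (i + 1) j, Bin i (j + 1))) ` S"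
  have "finite S" "card S = k * k" by (auto simp: S_def)
  then have c: "card A = k * k" "card B = k * k" "card C = k * k" "card D = k * k"
    and f: "finite A" "finite B" "finite C" "finite D"
    unfolding A_def B_def C_def D_def by ((subst card_image; auto simp: inj_on_def)+, auto)
  have d: "A \<inter> B = {}" "(A \<union> B) \<inter> C = {}" "(A \<union> B \<union> C) \<inter> D = {}"
    by (auto simp: A_def B_def C_def D_def)
  have "aztec_edges k = A \<union> B \<union> C \<union> D" (is "?L = ?R")
  proof
    show "?L \<subseteq> ?R"
      unfolding A_def B_def C_def D_def S_def
      by (auto simp: aztec_edges_def faces_def inner_blacks_def bpt_def image_iff
          split: if_splits)
    show "?R \<subseteq> ?L"
      by (auto simp: A_def B_def C_def D_def S_def aztec_edges_def faces_def inner_blacks_def bpt_def)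
  qed
  then show ?thesis
    using c d f by (simp add: card_Un_disjoint power2_eq_square)
qed

lemma card_aztec_faces:
  assumes "k \<ge> 1"
  shows "card (aztec_faces k) = k\<^sup>2 + (k - 1)\<^sup>2"
proof -
  define q1 where "q1 = (\<lambda>(i, j). [Inr (Bin i j), Inl (Face (i + 1) j), Inr (Bin i (j + 1)), Inl (Face i j)] :: avertex list)"
  define q2 where "q2 = (\<lambda>(i, j). [Inl (Face i (j - 1)), Inr (Bin i j), Inl (Face i j), Inr (Bin (i - 1) j)] :: avertex list)"
  have e: "aztec_faces k = q1 ` ({..<k} \<times> {..<k}) \<union> q2 ` ({0<..<k} \<times> {0<..<k})"
    by (auto simp: aztec_faces_def q1_def q2_def image_iff)
  have "card (q1 ` ({..<k} \<times> {..<k})) = k * k"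
    by (subst card_image) (auto simp: inj_on_def q1_def card_cartesian_product)
  moreover have "card (q2 ` ({0<..<k} \<times> {0<..<k})) = (k - 1) * (k - 1)"
    by (subst card_image) (auto simp: inj_on_def q2_def card_cartesian_product)
  ultimately show ?thesis
    unfolding e by (subst card_Un_disjoint) (auto simp: power2_eq_square q1_def q2_def)
qed

lemma euler_aztec:
  assumes "k \<ge> 1"
  shows "(card (faces k) + card (inner_blacks k)) + (card (aztec_faces k) + 1) = card (aztec_edges k) + 2"
proof -
  obtain m where "k = Suc m" using assms by (cases k) auto
  then show ?thesis
    using card_aztec_faces[OF assms]
    by (simp add: card_aztec_edges card_inner_blacks card_faces power2_eq_square)
qed

text \<open>A Kasteleyn orientation: \<open>-1\<close> exactly between each white vertex and the lower left corner of its face.\<close>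

lemma kasteleyn_orientation_exists: "\<exists>\<phi>. kasteleyn_orientation k \<phi>"
proof
  define s :: "face \<Rightarrow> bvertex \<Rightarrow> int" where
    "s = (\<lambda>w b. case (w, b) of (Face i j, Bin i' j') \<Rightarrow> if i = i' + 1 \<and> j = j' then -1 else 1 | _ \<Rightarrow> 1)"
  define \<phi> :: "avertex \<times> avertex \<Rightarrow> int" where
    "\<phi> = (\<lambda>p. case p of (Inl w, Inr b) \<Rightarrow> s w b | (Inr b, Inl w) \<Rightarrow> - s w b | _ \<Rightarrow> 1)"
  have s: "s w b \<in> {1, -1}" for w b
    by (auto simp: s_def split: face.splits bvertex.splits)
  have c: "cycle_edges [Inr b, Inl w, Inr b', Inl w'] = {(w, b), (w, b'), (w', b'), (w', b)}"
    "cycle_edges [Inl w, Inr b, Inl w', Inr b'] = {(w, b), (w', b), (w', b'), (w, b')}" for w b w' b'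
    by (auto simp: cycle_edges_def)
  have "(\<Prod>(w, b) \<in> cycle_edges f. \<phi> (Inl w, Inr b)) = -1 \<and> length f = 4" if "f \<in> aztec_faces k" for f
    using that by (auto simp: aztec_faces_def c \<phi>_def s_def gr0_conv_Suc)
  then show "kasteleyn_orientation k \<phi>"
    using s unfolding kasteleyn_orientation_def by (fastforce simp: \<phi>_def)
qed

definition C_mat :: "nat \<Rightarrow> (bedge \<Rightarrow> complex) \<Rightarrow> bedge \<Rightarrow> bvertex \<Rightarrow> complex" where
  "C_mat k a \<epsilon> b = a \<epsilon> * (if b = head_of k \<epsilon> then 1 else if b = tail_of k \<epsilon> then -1 else 0)"

text \<open>The rows of \<open>D\<close> are indexed by \<open>edges k\<close>, its columns by \<open>inner_blacks k <+> inner_blacks k\<close>.\<close>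

fun D_mat :: "nat \<Rightarrow> (bedge \<Rightarrow> complex) \<Rightarrow> bedge \<Rightarrow> bvertex + bvertex \<Rightarrow> complex" where
  "D_mat k a \<epsilon> (Inl b) = C_mat k (\<lambda>_. 1) \<epsilon> b"
| "D_mat k a \<epsilon> (Inr b) = C_mat k a \<epsilon> b"

end

theory Submission
  imports Defs "Jordan_Normal_Form.Determinant"
begin

text \<open>
  Any Kasteleyn orientation of \<open>A\<^sub>k\<close> is gauge equivalent to an explicit one, whose product over a
  perfect matching equals, up to a constant, the sign of the matching as a bijection of the
  lexicographically ordered faces and black vertices; this follows by counting inversions column by
  column. Hence $Z(A_k, a, \varphi)$ is a constant times $\det K(a)$, where $K(a)$ has the entries
  $a_{f(w,b)} - a_{f(b,w)}$ without signs.

  Let $t$ be the column of $C(1)$ at $\tilde b$. Multiplying the square matrix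
  $(t \mid C(1)^B \mid C(a)^B)$ by the boundaries of the faces and the indicators of the edges of a
  spanning tree makes it block triangular, with $K(a)$ as the only block that depends on $a$, so its
  determinant is a nonzero constant times $\det K(a)$. Dividing the rows of
  $(at \mid C(1)^B \mid C(a)^B)$ by $a$ yields $(t \mid C(a^{-1})^B \mid C(1)^B)$, so that $Y(A_k, a)$ is
  the quotient of the determinants of $(at \mid D)$ and $(t \mid D)$. Put $U = v \cdot at$ and
  $V = v \cdot t$. As $v$ is orthogonal to $V at - U t$ and to the columns of $D$, the determinant of
  $(V at - U t \mid D)$ vanishes, which by linearity means that the quotient is $U / V$.
\<close>

subsection \<open>Inversions\<close>

definition inversions :: "nat \<Rightarrow> (nat \<Rightarrow> nat) \<Rightarrow> (nat \<times> nat) set" where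
  "inversions n p = {(x, y). x < y \<and> y < n \<and> p y < p x}"

lemma finite_inversions: "finite (inversions n p)"
  by (rule finite_subset[of _ "{..<n} \<times> {..<n}"]) (auto simp: inversions_def)

text \<open>Each of the \<open>b - a - 1\<close> values strictly between \<open>a\<close> and
  \<open>b\<close> is inverted with both of them, and \<open>a\<close> and \<open>b\<close> are
  inverted with each other.\<close>

lemma card_inversions_transpose:
  assumes "a < b" "b < n"
  shows "odd (card (inversions n (transpose a b)))"
proof -
  have "inversions n (transpose a b) = {a} \<times> {a<..b} \<union> {a<..<b} \<times> {b}"
    using assms by (auto simp: inversions_def transpose_def split: if_splits)
  moreover have "card ({a} \<times> {a<..b} \<union> {a<..<b} \<times> {b}) = (b - a) + (b - a - 1)"
    by (subst card_Un_disjoint) auto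
  ultimately show ?thesis
    using assms by simp
qed

text \<open>A pair of positions is inverted by exactly one of \<open>q \<circ> p\<close> and
  \<open>p\<close> iff \<open>q\<close> inverts its pair of images under \<open>p\<close>. So
  \<open>p\<close> carries the symmetric difference of these two inversion sets onto that of
  \<open>q\<close>, and their common part is counted twice.\<close>

lemma card_inversions_compose:
  assumes p: "p permutes {0..<n}" and q: "q permutes {0..<n}"
  shows "even (card (inversions n (q \<circ> p)) + card (inversions n p) + card (inversions n q))"
proof -
  define A B where "A = inversions n (q \<circ> p)" and "B = inversions n p"
  have fin: "finite A" "finite B"
    by (simp_all add: A_def B_def finite_inversions)
  have lt: "p x < n \<longleftrightarrow> x < n" "q x < n \<longleftrightarrow> x < n" for x
    using permutes_in_image[OF p, of x] permutes_in_image[OF q, of x] by auto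
  have inj: "p x = p y \<longleftrightarrow> x = y" "q x = q y \<longleftrightarrow> x = y" for x y
    using permutes_inj[OF p] permutes_inj[OF q] by (auto simp: inj_eq)
  define r where "r = inv_into UNIV p"
  have rp: "r permutes {0..<n}"
    unfolding r_def using p by (rule permutes_inv)
  have r: "r u < n \<longleftrightarrow> u < n" "p (r u) = u" "r (p u) = u" "r u = r v \<longleftrightarrow> u = v" for u v
    using permutes_in_image[OF rp, of u] permutes_inverses[OF p] permutes_inj[OF rp]
    by (simp_all add: r_def inj_eq)
  \<comment> \<open>Members of \<open>inversions\<close> are increasing pairs, so the images have to
    be sorted.\<close>
  have "bij_betw (\<lambda>(x, y). (min (p x) (p y), max (p x) (p y))) ((A - B) \<union> (B - A)) (inversions n q)"
  proof (rule bij_betwI[where g = "\<lambda>(u, v). (min (r u) (r v), max (r u) (r v))"], goal_cases)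
    case 1
    have "(min (p x) (p y), max (p x) (p y)) \<in> inversions n q" if "(x, y) \<in> (A - B) \<union> (B - A)" for x y
    proof -
      have xy: "x < y" "y < n" "q (p y) < q (p x) \<longleftrightarrow> \<not> p y < p x"
        using that by (auto simp: A_def B_def inversions_def)
      have ne: "p x \<noteq> p y" "q (p x) \<noteq> q (p y)" "x < n"
        using xy(1,2) inj by auto
      show ?thesis
        by (cases "p x" "p y" rule: linorder_cases)
          (use xy ne lt in \<open>simp_all add: inversions_def\<close>)
    qed
    then show ?case by auto
  next
    case 2
    have "(min (r u) (r v), max (r u) (r v)) \<in> (A - B) \<union> (B - A)" if "(u, v) \<in> inversions n q" for u v
    proof -
      have uv: "u < v" "v < n" "q v < q u"
        using that by (auto simp: inversions_def)
      then have ne: "r u \<noteq> r v" "u < n"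
        using r by auto
      show ?thesis
        by (cases "r u" "r v" rule: linorder_cases)
          (use uv ne r in \<open>simp_all add: A_def B_def inversions_def\<close>)
    qed
    then show ?case by auto
  next
    case (3 z)
    then obtain x y where "z = (x, y)" "x < y"
      by (auto simp: A_def B_def inversions_def)
    then show ?case
      by (cases "p x" "p y" rule: linorder_cases) (simp_all add: r inj)
  next
    case (4 z)
    then obtain u v where "z = (u, v)" "u < v"
      by (auto simp: inversions_def)
    then show ?case
      by (cases "r u" "r v" rule: linorder_cases) (simp_all add: r)
  qed
  then have c: "card (A - B) + card (B - A) = card (inversions n q)"
    using fin by (subst card_Un_disjoint[symmetric]) (auto dest: bij_betw_same_card)
  have "card A = card (A - B) + card (A \<inter> B)" "card B = card (B - A) + card (A \<inter> B)"
    using fin by (metis card_Diff_subset_Int card_mono Int_lower1 Int_commute le_add_diff_inverse2 finite_Int)+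
  with c show ?thesis
    unfolding A_def[symmetric] B_def[symmetric] by (auto simp flip: c)
qed

text \<open>Composing with a transposition on the left negates the sign, and by the two preceding
  lemmas it changes the parity of the number of inversions.\<close>

lemma sign_eq_inversions:
  assumes "p permutes {0..<n}"
  shows "sign p = (-1) ^ card (inversions n p)"
proof -
  have "finite {0..<n}" by simp
  from assms this show ?thesis
  proof (induction rule: permutes_induct)
    case id
    have "inversions n id = {}" by (auto simp: inversions_def)
    then show ?case by (simp add: id_def)
  next
    case (swap a b p)
    have t: "transpose a b permutes {0..<n}"
      using swap by (simp add: permutes_swap_id)
    have "odd (card (inversions n (transpose a b)))"
      using swap card_inversions_transpose[of a b n] card_inversions_transpose[of b a n]
      by (cases a b rule: linorder_cases) (auto simp: transpose_commute)
    then have "odd (card (inversions n (transpose a b \<circ> p)) + card (inversions n p))"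
      using card_inversions_compose[OF swap(4) t] by simp
    then have "(-1::int) ^ card (inversions n (transpose a b \<circ> p)) = - ((-1) ^ card (inversions n p))"
      by (auto simp: minus_one_power_iff)
    moreover have "sign (transpose a b \<circ> p) = - sign p"
      using swap t by (subst sign_compose) (auto simp: sign_swap_id permutation_permutes)
    ultimately show ?case
      using swap(4,5) by (simp only:)
  qed
qed

text \<open>An element \<open>y\<close> of \<open>S\<close> is paired with all \<open>y\<close>
  smaller numbers except those in \<open>S\<close>. Over all \<open>y\<close> these exceptions are
  the two-element subsets of \<open>S\<close>, whence the binomial coefficient.\<close>

lemma card_inverted_pairs:
  assumes "finite S"
  shows "card {(x::nat, y). x < y \<and> x \<notin> S \<and> y \<in> S} + (card S choose 2) = \<Sum>S"
  using assms
proof (induction S rule: finite_linorder_max_induct)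
  case empty
  then show ?case by simp
next
  case (insert b S)
  let ?P = "\<lambda>S. {(x::nat, y). x < y \<and> x \<notin> S \<and> y \<in> S}"
  \<comment> \<open>The new element \<open>b\<close> exceeds all of \<open>S\<close>, so the old
    pairs persist and \<open>b\<close> occurs only as a second component.\<close>
  have "?P (insert b S) = ?P S \<union> ({..<b} - S) \<times> {b}"
    using insert by (auto dest: less_trans)
  moreover have "finite (?P S)"
    by (rule finite_subset[of _ "{..<b} \<times> S"]) (use insert in \<open>auto dest: less_trans\<close>)
  moreover have "b \<notin> S" using insert by auto
  moreover have "card ({..<b} - S) + card S = b"
    using insert card_mono[of "{..<b}" S] by (subst card_Diff_subset) (auto simp: subset_iff)
  ultimately have "card (?P (insert b S)) = card (?P S) + (b - card S)"
    by (simp only:) (subst card_Un_disjoint; use insert in \<open>auto simp: card_cartesian_product\<close>)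
  then show ?case
    using insert \<open>b \<notin> S\<close> \<open>card ({..<b} - S) + card S = b\<close> by (simp add: numeral_2_eq_2)
qed

subsection \<open>The sign of a perfect matching\<close>

definition lex_less :: "nat \<times> nat \<Rightarrow> nat \<times> nat \<Rightarrow> bool" where
  "lex_less x y \<longleftrightarrow> fst x < fst y \<or> fst x = fst y \<and> snd x < snd y"

text \<open>A perfect matching in coordinates: \<open>\<sigma> (i, j) = (i', j')\<close> says that \<open>Face i j\<close> is matched with
  \<open>Bin i' j'\<close>; \<open>\<tau>\<close> is the inverse. Column \<open>i\<close> of the faces lies between the columns \<open>i - 1\<close> and \<open>i\<close> of the
  black vertices.\<close>

locale aztec_bijection =
  fixes k :: nat and \<sigma> \<tau> :: "nat \<times> nat \<Rightarrow> nat \<times> nat"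
  assumes \<sigma>: "w \<in> {..k} \<times> {..<k} \<Longrightarrow> \<sigma> w \<in> {..<k} \<times> {..k} \<and> \<tau> (\<sigma> w) = w"
    and \<tau>: "b \<in> {..<k} \<times> {..k} \<Longrightarrow> \<tau> b \<in> {..k} \<times> {..<k} \<and> \<sigma> (\<tau> b) = b"
    and adjacent: "w \<in> {..k} \<times> {..<k} \<Longrightarrow>
      (fst w = fst (\<sigma> w) \<or> fst w = fst (\<sigma> w) + 1) \<and> (snd (\<sigma> w) = snd w \<or> snd (\<sigma> w) = snd w + 1)"
begin

text \<open>Heights at which a column is matched to its left. For a face this means black column
  \<open>i - 1\<close>, by \<open>adjacent\<close>; for a black vertex of column \<open>i\<close> it
  means face column \<open>i\<close>.\<close>

definition whites_left :: "nat \<Rightarrow> nat set" where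
  "whites_left i = {j. j < k \<and> fst (\<sigma> (i, j)) \<noteq> i}"

definition blacks_left :: "nat \<Rightarrow> nat set" where
  "blacks_left i = {j. j \<le> k \<and> fst (\<tau> (i, j)) = i}"

lemma finite_left [simp]: "finite (whites_left i)" "finite (blacks_left i)"
  by (auto simp: whites_left_def blacks_left_def)

lemma white_cases:
  assumes "i \<le> k" "j < k"
  obtains (left) i' j' where "i = Suc i'" "i' < k" "j' \<le> k" "\<sigma> (i, j) = (i', j')" "\<tau> (i', j') = (i, j)"
      "j' = j \<or> j' = j + 1" "j \<in> whites_left i" "j' \<notin> blacks_left i'"
  | (right) j' where "i < k" "j' \<le> k" "\<sigma> (i, j) = (i, j')" "\<tau> (i, j') = (i, j)"
      "j' = j \<or> j' = j + 1" "j \<notin> whites_left i" "j' \<in> blacks_left i"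
proof -
  obtain i' j' where s: "\<sigma> (i, j) = (i', j')" by fastforce
  have *: "i' < k" "j' \<le> k" "\<tau> (i', j') = (i, j)" "i = i' \<or> i = i' + 1" "j' = j \<or> j' = j + 1"
    using \<sigma>[of "(i, j)"] adjacent[of "(i, j)"] assms s by auto
  show thesis
  proof (cases "i = i'")
    case True
    then show thesis
      using right[of j'] s * assms by (auto simp: whites_left_def blacks_left_def)
  next
    case False
    then show thesis
      using left[of i' j'] s * assms by (auto simp: whites_left_def blacks_left_def)
  qed
qed

lemma black_cases:
  assumes "i < k" "j \<le> k"
  obtains (left) j' where "j' < k" "\<tau> (i, j) = (i, j')" "\<sigma> (i, j') = (i, j)"
      "j \<in> blacks_left i" "j' \<notin> whites_left i"
  | (right) j' where "j' < k" "\<tau> (i, j) = (Suc i, j')" "\<sigma> (Suc i, j') = (i, j)"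
      "j \<notin> blacks_left i" "j' \<in> whites_left (Suc i)"
proof -
  obtain i' j' where t: "\<tau> (i, j) = (i', j')" by fastforce
  have *: "i' \<le> k" "j' < k" "\<sigma> (i', j') = (i, j)" "i' = i \<or> i' = Suc i"
    using \<tau>[of "(i, j)"] adjacent[of "(i', j')"] assms t by auto
  show thesis
    using left[of j'] right[of j'] t * assms by (auto simp: whites_left_def blacks_left_def)
qed

text \<open>The matching pairs the right-going faces of column \<open>i\<close> with the left-going
  black vertices of column \<open>i\<close>, and the right-going black vertices of that column with
  the left-going faces of column \<open>i + 1\<close>. A column has \<open>k\<close> faces or
  \<open>k + 1\<close> black vertices.\<close>

lemma card_left:
  assumes "i < k"
  shows "card (whites_left i) + card (blacks_left i) = k"
    and "card (blacks_left i) + card (whites_left (Suc i)) = k + 1"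
proof -
  have "bij_betw (\<lambda>j. snd (\<sigma> (i, j))) ({..<k} - whites_left i) (blacks_left i)"
  proof (rule bij_betwI[where g = "\<lambda>j. snd (\<tau> (i, j))"], goal_cases)
    case 1
    show ?case
    proof
      fix j assume j: "j \<in> {..<k} - whites_left i"
      then have "i \<le> k" "j < k" using assms by auto
      then show "snd (\<sigma> (i, j)) \<in> blacks_left i"
        by (rule white_cases) (use j in auto)
    qed
  next
    case 2
    show ?case
    proof
      fix j assume j: "j \<in> blacks_left i"
      then have "j \<le> k" by (simp add: blacks_left_def)
      then show "snd (\<tau> (i, j)) \<in> {..<k} - whites_left i"
        by (rule black_cases[OF assms]) (use j in auto)
    qed
  next
    case (3 j)
    then have "i \<le> k" "j < k" using assms by auto
    then show ?case
      by (rule white_cases) (use 3 in auto)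
  next
    case (4 j)
    then have "j \<le> k" by (simp add: blacks_left_def)
    then show ?case
      by (rule black_cases[OF assms]) (use 4 in auto)
  qed
  from bij_betw_same_card[OF this]
  have "card ({..<k} - whites_left i) = card (blacks_left i)" .
  moreover have "whites_left i \<subseteq> {..<k}" by (auto simp: whites_left_def)
  ultimately show "card (whites_left i) + card (blacks_left i) = k"
    using card_mono[of "{..<k}" "whites_left i"] by (auto simp: card_Diff_subset)
  have "bij_betw (\<lambda>j. snd (\<tau> (i, j))) ({..k} - blacks_left i) (whites_left (Suc i))"
  proof (rule bij_betwI[where g = "\<lambda>j. snd (\<sigma> (Suc i, j))"], goal_cases)
    case 1
    show ?case
    proof
      fix j assume j: "j \<in> {..k} - blacks_left i"
      then have "j \<le> k" by simp
      then show "snd (\<tau> (i, j)) \<in> whites_left (Suc i)"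
        by (rule black_cases[OF assms]) (use j in auto)
    qed
  next
    case 2
    show ?case
    proof
      fix j assume j: "j \<in> whites_left (Suc i)"
      then have "j < k" by (simp add: whites_left_def)
      then show "snd (\<sigma> (Suc i, j)) \<in> {..k} - blacks_left i"
        by (rule white_cases[OF Suc_leI[OF assms]]) (use j in auto)
    qed
  next
    case (3 j)
    then have "j \<le> k" by simp
    then show ?case
      by (rule black_cases[OF assms]) (use 3 in auto)
  next
    case (4 j)
    then have "j < k" by (simp add: whites_left_def)
    then show ?case
      by (rule white_cases[OF Suc_leI[OF assms]]) (use 4 in auto)
  qed
  from bij_betw_same_card[OF this]
  have "card ({..k} - blacks_left i) = card (whites_left (Suc i))" .
  moreover have "blacks_left i \<subseteq> {..k}" by (auto simp: blacks_left_def)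
  ultimately show "card (blacks_left i) + card (whites_left (Suc i)) = k + 1"
    using card_mono[of "{..k}" "blacks_left i"] by (auto simp: card_Diff_subset)
qed

text \<open>No black vertex lies to the left of face column 0, and passing to the next face column
  through \<open>card_left\<close> adds one. So the size is the same for every matching.\<close>

lemma card_whites_left: "i \<le> k \<Longrightarrow> card (whites_left i) = i"
proof (induction i)
  case 0
  have "whites_left 0 = {}"
    using adjacent[of "(0, _)"] by (fastforce simp: whites_left_def)
  then show ?case by simp
next
  case (Suc i)
  then show ?case using card_left[of i] by simp
qed

lemma card_blacks_left: "i < k \<Longrightarrow> card (blacks_left i) = k - i"
  using card_left(1)[of i] card_whites_left[of i] by simp

definition pair_inversions :: "((nat \<times> nat) \<times> nat \<times> nat) set" where
  "pair_inversions = {(w, w'). w \<in> {..k} \<times> {..<k} \<and> w' \<in> {..k} \<times> {..<k} \<and> lex_less w w' \<and> lex_less (\<sigma> w') (\<sigma> w)}"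

text \<open>Edges joining the same two columns preserve the vertical order. So the inversions are formed by
  two faces of one column, the lower one matched to the right and the upper one to the left, or by two
  faces matched into one column of black vertices from both of its sides.\<close>

lemma pair_inversions_same_column:
  "bij_betw (\<lambda>(i, j, j'). ((i, j), (i, j')))
     (SIGMA i:{..k}. {(j, j'). j < j' \<and> j \<notin> whites_left i \<and> j' \<in> whites_left i})
     {(w, w') \<in> pair_inversions. fst w = fst w'}"
proof (rule bij_betwI[where g = "\<lambda>(w, w'). (fst w, snd w, snd w')"], goal_cases)
  case 1
  have "lex_less (\<sigma> (i, j')) (\<sigma> (i, j))"
    if "i \<le> k" "j < j'" "j \<notin> whites_left i" "j' \<in> whites_left i" for i j j'
  proof -
    have "j' < k" using that by (simp add: whites_left_def)
    then have "j < k" using that by simp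
    show ?thesis
      by (rule white_cases[OF \<open>i \<le> k\<close> \<open>j < k\<close>]; rule white_cases[OF \<open>i \<le> k\<close> \<open>j' < k\<close>])
        (use that in \<open>simp_all add: lex_less_def\<close>)
  qed
  then show ?case
    by (auto simp: pair_inversions_def lex_less_def whites_left_def)
next
  case 2
  have "j \<notin> whites_left i \<and> j' \<in> whites_left i"
    if "i \<le> k" "j < j'" "j' < k" "lex_less (\<sigma> (i, j')) (\<sigma> (i, j))" for i j j'
    by (rule white_cases[OF \<open>i \<le> k\<close> less_trans[OF that(2,3)]]; rule white_cases[OF \<open>i \<le> k\<close> \<open>j' < k\<close>])
      (use that in \<open>auto simp: lex_less_def\<close>)
  then show ?case
    by (auto simp: pair_inversions_def lex_less_def)
qed auto

lemma pair_inversions_diff_column: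
  "bij_betw (\<lambda>(i, j, j'). (\<tau> (i, j'), \<tau> (i, j)))
     (SIGMA i:{..<k}. {(j, j'). j < j' \<and> j \<notin> blacks_left i \<and> j' \<in> blacks_left i})
     {(w, w') \<in> pair_inversions. fst w \<noteq> fst w'}"
\<comment> \<open>For faces in different columns an inversion forces both partners into the column
  of the first face, which is therefore the index \<open>i\<close>.\<close>
proof (rule bij_betwI[where g = "\<lambda>(w, w'). (fst w, snd (\<sigma> w'), snd (\<sigma> w))"], goal_cases)
  case 1
  have "(\<tau> (i, j'), \<tau> (i, j)) \<in> pair_inversions \<and> fst (\<tau> (i, j')) \<noteq> fst (\<tau> (i, j))"
    if "i < k" "j < j'" "j \<notin> blacks_left i" "j' \<in> blacks_left i" for i j j'
  proof -
    have "j' \<le> k" using that by (simp add: blacks_left_def)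
    then have "j \<le> k" using that by simp
    show ?thesis
      by (rule black_cases[OF \<open>i < k\<close> \<open>j \<le> k\<close>]; rule black_cases[OF \<open>i < k\<close> \<open>j' \<le> k\<close>])
        (use that in \<open>simp_all add: lex_less_def pair_inversions_def\<close>)
  qed
  then show ?case by auto
next
  case 2
  show ?case
  proof
    fix z assume "z \<in> {(w, w'). (w, w') \<in> pair_inversions \<and> fst w \<noteq> fst w'}"
    then obtain i j i' j' where z: "z = ((i, j), (i', j'))" "i < i'" "j < k" "i' \<le> k" "j' < k"
        "lex_less (\<sigma> (i', j')) (\<sigma> (i, j))"
      by (auto simp: pair_inversions_def lex_less_def)
    then have "i \<le> k" by simp
    have "i < k \<and> snd (\<sigma> (i', j')) < snd (\<sigma> (i, j)) \<and> snd (\<sigma> (i', j')) \<notin> blacks_left i \<and>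
        snd (\<sigma> (i, j)) \<in> blacks_left i"
      by (rule white_cases[OF \<open>i \<le> k\<close> \<open>j < k\<close>]; rule white_cases[OF \<open>i' \<le> k\<close> \<open>j' < k\<close>])
        (use z in \<open>simp_all add: lex_less_def\<close>)
    then show "(case z of (w, w') \<Rightarrow> (fst w, snd (\<sigma> w'), snd (\<sigma> w)))
        \<in> (SIGMA i:{..<k}. {(j, j'). j < j' \<and> j \<notin> blacks_left i \<and> j' \<in> blacks_left i})"
      by (simp add: z(1))
  qed
next
  case (3 z)
  then obtain i j j' where z: "z = (i, j, j')" "i < k" "j < j'" "j \<notin> blacks_left i" "j' \<in> blacks_left i"
    by auto
  then have "j' \<le> k" "j \<le> k" by (auto simp: blacks_left_def)
  then have "\<sigma> (\<tau> (i, j)) = (i, j)" "\<sigma> (\<tau> (i, j')) = (i, j')" "fst (\<tau> (i, j')) = i"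
    using z \<tau> by (auto simp: blacks_left_def)
  then show ?case
    by (simp add: z(1))
next
  case (4 z)
  then obtain i j i' j' where z: "z = ((i, j), (i', j'))" "i < i'" "j < k" "i' \<le> k" "j' < k"
      "lex_less (\<sigma> (i', j')) (\<sigma> (i, j))"
    by (auto simp: pair_inversions_def lex_less_def)
  then have "i \<le> k" by simp
  show ?case
    by (rule white_cases[OF \<open>i \<le> k\<close> \<open>j < k\<close>]; rule white_cases[OF \<open>i' \<le> k\<close> \<open>j' < k\<close>])
      (use z in \<open>simp_all add: lex_less_def\<close>)
qed

text \<open>The height that enters \<open>whites_left\<close> or \<open>blacks_left\<close>: that of
  the face if it is matched to its left, otherwise that of its black vertex.\<close>

definition exponent :: "nat \<times> nat \<Rightarrow> nat" where
  "exponent w = (if fst w = fst (\<sigma> w) then snd (\<sigma> w) else snd w)"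

lemma sum_exponent:
  "(\<Sum>w \<in> {..k} \<times> {..<k}. exponent w) =
     (\<Sum>i\<le>k. \<Sum>(whites_left i)) + (\<Sum>i<k. \<Sum>(blacks_left i))"
proof -
  let ?W = "{..k} \<times> {..<k}"
  have "(\<Sum>w \<in> ?W. exponent w) =
      (\<Sum>w \<in> ?W \<inter> {w. fst w = fst (\<sigma> w)}. snd (\<sigma> w)) +
      (\<Sum>w \<in> ?W \<inter> - {w. fst w = fst (\<sigma> w)}. snd w)"
    unfolding exponent_def by (rule sum.If_cases) simp
  also have "?W \<inter> - {w. fst w = fst (\<sigma> w)} = Sigma {..k} whites_left"
    by (auto simp: whites_left_def)
  also have "(\<Sum>w \<in> Sigma {..k} whites_left. snd w) = (\<Sum>i\<le>k. \<Sum>(whites_left i))"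
    by (subst sum.Sigma) (auto intro!: sum.cong)
  also have "(\<Sum>w \<in> ?W \<inter> {w. fst w = fst (\<sigma> w)}. snd (\<sigma> w)) = (\<Sum>b \<in> Sigma {..<k} blacks_left. snd b)"
  proof (rule sum.reindex_bij_witness[where i = \<tau> and j = \<sigma>], goal_cases)
    case (1 w)
    then show ?case using \<sigma> by auto
  next
    case (2 w)
    then obtain i j where w: "w = (i, j)" "i \<le> k" "j < k" "fst (\<sigma> w) = i" by auto
    show ?case by (rule white_cases[OF \<open>i \<le> k\<close> \<open>j < k\<close>]) (use w in auto)
  next
    case (3 b)
    then show ?case using \<tau> by (auto simp: blacks_left_def)
  next
    case (4 b)
    then show ?case using \<tau>[of b] by (auto simp: blacks_left_def)
  qed simp
  also have "\<dots> = (\<Sum>i<k. \<Sum>(blacks_left i))"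
    by (subst sum.Sigma) (auto intro!: sum.cong)
  finally show ?thesis by (simp only: add.commute)
qed

text \<open>By \<open>card_inverted_pairs\<close> each column contributes the sum of its heights
  minus a binomial coefficient in the size of its set. The sizes are \<open>i\<close> and
  \<open>k - i\<close>, so the correction does not depend on the matching.\<close>

lemma card_pair_inversions:
  "card pair_inversions + ((\<Sum>i\<le>k. i choose 2) + (\<Sum>i<k. (k - i) choose 2)) =
     (\<Sum>w \<in> {..k} \<times> {..<k}. exponent w)"
proof -
  let ?P = "\<lambda>S. {(x::nat, y). x < y \<and> x \<notin> S \<and> y \<in> S}"
  have fin: "finite (?P S)" if "finite S" for S
    by (rule finite_subset[of _ "{..<Max S} \<times> S"])
      (use that in \<open>auto intro: less_le_trans[OF _ Max_ge]\<close>)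
  have "finite pair_inversions"
    by (rule finite_subset[of _ "({..k} \<times> {..<k}) \<times> ({..k} \<times> {..<k})"]) (auto simp: pair_inversions_def)
  then have "card pair_inversions = card {(w, w') \<in> pair_inversions. fst w = fst w'} +
      card {(w, w') \<in> pair_inversions. fst w \<noteq> fst w'}"
    by (subst card_Un_disjoint[symmetric])
      (auto intro: finite_subset[of _ pair_inversions] arg_cong[where f = card])
  also have "\<dots> = (\<Sum>i\<le>k. card (?P (whites_left i))) + (\<Sum>i<k. card (?P (blacks_left i)))"
    using bij_betw_same_card[OF pair_inversions_same_column] bij_betw_same_card[OF pair_inversions_diff_column]
    by (simp add: card_SigmaI fin)
  finally have "card pair_inversions + ((\<Sum>i\<le>k. i choose 2) + (\<Sum>i<k. (k - i) choose 2)) =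
      (\<Sum>i\<le>k. card (?P (whites_left i)) + (card (whites_left i) choose 2)) +
      (\<Sum>i<k. card (?P (blacks_left i)) + (card (blacks_left i) choose 2))"
    by (simp add: sum.distrib card_whites_left card_blacks_left)
  then show ?thesis
    by (simp add: card_inverted_pairs sum_exponent)
qed

end

subsection \<open>Kasteleyn orientations up to gauge\<close>

lemma aztec_edges_iff:
  "(w, b) \<in> aztec_edges k \<longleftrightarrow>
     (\<exists>i j i' j'. w = Face i j \<and> b = Bin i' j' \<and> i' < k \<and> j < k \<and> (i = i' \<or> i = i' + 1) \<and> (j' = j \<or> j' = j + 1))"
  by (auto simp: aztec_edges_def faces_def inner_blacks_def bpt_def split: if_splits)

lemma int_mult_eq_1_imp_eq: "x = y" if "x * y = 1" for x y :: int
  using that by (auto simp: zmult_eq_1_iff)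

lemma int_unit_cancel:
  fixes x y :: int
  assumes "\<bar>x\<bar> = 1"
  shows "x * x = 1" and "x * (x * y) = y"
  using assms by (auto simp: abs_if split: if_splits)

text \<open>\<open>A\<close>, \<open>B\<close>, \<open>C\<close>, \<open>D\<close> live on the four
  edges of the Aztec diamond around \<open>Ver i j\<close>; \<open>flat1\<close> and
  \<open>flat2\<close> are its two kinds of bounded faces. Signs propagated along a spanning tree
  fit the other edges because the product around each bounded face is 1.\<close>

lemma flat_gauge:
  fixes A B C D :: "nat \<Rightarrow> nat \<Rightarrow> int"
  assumes unit: "\<And>i j. i < k \<Longrightarrow> j < k \<Longrightarrow>
      {A i j, B i j, C i j, D i j} \<subseteq> {1, -1}"
    and flat1: "\<And>i j. i < k \<Longrightarrow> j < k \<Longrightarrow> A i j * B i j * C i j * D i j = 1"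
    and flat2: "\<And>i j. i + 1 < k \<Longrightarrow> j + 1 < k \<Longrightarrow>
      B (i + 1) j * A (i + 1) (j + 1) * C i (j + 1) * D i j = 1"
  shows "\<exists>s t. \<forall>i<k. \<forall>j<k. A i j = s i j * t i j \<and> B i j = s i j * t i (j + 1) \<and>
      C i j = s (i + 1) j * t i j \<and> D i j = s (i + 1) j * t i (j + 1)"
proof -
  \<comment> \<open>Propagation from \<open>t 0 0 = 1\<close>: up the zigzag of column 0, then
    through \<open>C\<close> to the next faces and through \<open>A\<close> to the next black
    vertices. The top vertex \<open>j = k\<close> has no face at its own height and is reached
    through \<open>B\<close> from the face below.\<close>
  define t where "t = rec_nat (\<lambda>j. \<Prod>l<j. A 0 l * B 0 l)
    (\<lambda>i t j. if j < k then A (Suc i) j * C i j * t j else B (Suc i) (j - 1) * C i (j - 1) * t (j - 1))"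
  have t0: "t 0 j = (\<Prod>l<j. A 0 l * B 0 l)"
    and tS: "t (Suc i) j = (if j < k then A (Suc i) j * C i j * t i j
        else B (Suc i) (j - 1) * C i (j - 1) * t i (j - 1))" for i j
    by (simp_all add: t_def)
  define s where "s = (\<lambda>i j. case i of 0 \<Rightarrow> A 0 j * t 0 j | Suc i \<Rightarrow> C i j * t i j)"
  have s0: "s 0 j = A 0 j * t 0 j" and sS: "s (Suc i) j = C i j * t i j" for i j
    by (simp_all add: s_def)
  have u: "\<bar>A i j\<bar> = 1" "\<bar>B i j\<bar> = 1" "\<bar>C i j\<bar> = 1" "\<bar>D i j\<bar> = 1" if "i < k" "j < k" for i j
    using unit[OF that] by auto
  \<comment> \<open>The face relations express the edges off the spanning tree: all
    \<open>D\<close>, and \<open>B\<close> away from column 0 and the top.\<close>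
  have D: "D i j = A i j * B i j * C i j" if "i < k" "j < k" for i j
    using int_mult_eq_1_imp_eq[of "D i j" "A i j * B i j * C i j"] flat1[OF that] by (simp add: ac_simps)
  have B: "B (Suc i) j = A (Suc i) (Suc j) * C i (Suc j) * D i j" if "Suc i < k" "Suc j < k" for i j
    using int_mult_eq_1_imp_eq[of "B (Suc i) j" "A (Suc i) (Suc j) * C i (Suc j) * D i j"] flat2[of i j] that
    by (simp add: ac_simps)
  have main: "(\<forall>j\<le>k. \<bar>t i j\<bar> = 1) \<and>
      (\<forall>j<k. A i j = s i j * t i j \<and> B i j = s i j * t i (Suc j))" if "i < k" for i
    using that
  proof (induction i)
    case 0
    have t: "\<bar>t 0 j\<bar> = 1" if "j \<le> k" for j
      using that
    proof (induction j)
      case (Suc j)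
      then show ?case
        using u[of 0 j] \<open>0 < k\<close> by (simp add: t0 abs_mult)
    qed (simp add: t0)
    have "A 0 j = s 0 j * t 0 j \<and> B 0 j = s 0 j * t 0 (Suc j)" if "j < k" for j
    proof -
      have "t 0 (Suc j) = t 0 j * (A 0 j * B 0 j)"
        by (simp add: t0)
      then show ?thesis
        using t[of j] u[of 0 j] that \<open>0 < k\<close> by (simp add: s0 ac_simps int_unit_cancel)
    qed
    with t show ?case by blast
  next
    case (Suc i)
    then have i: "i < k" by simp
    have t: "\<bar>t i j\<bar> = 1" if "j \<le> k" for j
      using Suc.IH[OF i] that by blast
    have AB: "A i j = s i j * t i j" "B i j = s i j * t i (Suc j)" if "j < k" for j
      using Suc.IH[OF i] that by blast+
    have tS': "\<bar>t (Suc i) j\<bar> = 1" if "j \<le> k" for j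
    proof (cases "j < k")
      case True
      then show ?thesis
        using t[of j] u[of "Suc i" j] u[of i j] Suc.prems by (simp add: tS abs_mult)
    next
      case False
      then have "j - 1 < k" using i that by simp
      then show ?thesis
        using False t[of "j - 1"] u[of "Suc i" "j - 1"] u[of i "j - 1"] Suc.prems by (simp add: tS abs_mult)
    qed
    have "A (Suc i) j = s (Suc i) j * t (Suc i) j \<and> B (Suc i) j = s (Suc i) j * t (Suc i) (Suc j)"
      if j: "j < k" for j
    proof
      have cancel: "\<bar>C i j\<bar> = 1" "\<bar>t i j\<bar> = 1"
        using u[OF i j] t[of j] j by auto
      then show "A (Suc i) j = s (Suc i) j * t (Suc i) j"
        using j by (simp add: tS sS ac_simps int_unit_cancel)
      show "B (Suc i) j = s (Suc i) j * t (Suc i) (Suc j)"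
      \<comment> \<open>Below the top, \<open>B\<close> is off the tree and follows from
        \<open>flat2\<close>; at the top it was used to define \<open>t\<close>.\<close>
      proof (cases "Suc j < k")
        case True
        have "\<bar>s i j\<bar> = 1"
          using AB(1)[OF j] cancel u(1)[OF i j] by (simp add: abs_mult)
        then have "D i j = C i j * t i j * t i (Suc j)"
          using D[OF i j] AB[OF j] by (simp add: ac_simps int_unit_cancel)
        moreover have "t (Suc i) (Suc j) = A (Suc i) (Suc j) * C i (Suc j) * t i (Suc j)"
          using True by (simp add: tS)
        ultimately show ?thesis
          using B[OF Suc.prems True] by (simp add: sS)
      next
        case False
        then have "t (Suc i) (Suc j) = B (Suc i) j * C i j * t i j"
          by (simp add: tS)
        then show ?thesis
          using cancel by (simp add: sS ac_simps int_unit_cancel)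
      qed
    qed
    with tS' show ?case by blast
  qed
  have "A i j = s i j * t i j \<and> B i j = s i j * t i (j + 1) \<and>
      C i j = s (i + 1) j * t i j \<and> D i j = s (i + 1) j * t i (j + 1)" if "i < k" "j < k" for i j
  proof -
    have AB: "A i j = s i j * t i j" "B i j = s i j * t i (Suc j)" and t: "\<bar>t i j\<bar> = 1"
      using main[OF that(1)] that(2) by auto
    have c: "C i j = s (Suc i) j * t i j"
      using t by (simp add: sS ac_simps int_unit_cancel)
    have "\<bar>s i j\<bar> = 1"
      using AB t u(1)[OF that] by (simp add: abs_mult)
    then have "D i j = s (Suc i) j * t i (Suc j)"
      using D[OF that] AB by (simp add: sS ac_simps int_unit_cancel)
    with AB c show ?thesis by simp
  qed
  then show ?thesis by blast
qed

text \<open>The exponents are those of \<open>exponent\<close>, which sum up to the number of inversions and a constant.\<close>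

fun aztec_sign :: "face \<Rightarrow> bvertex \<Rightarrow> int" where
  "aztec_sign (Face i j) (Bin i' j') = (if i = i' then (-1) ^ j' else (-1) ^ j)"
| "aztec_sign w b = 1"

text \<open>Both \<open>\<phi>\<close> and \<open>aztec_sign\<close> have product -1 around every
  bounded quadrilateral. Their product \<open>e\<close> thus has product 1 there, and
  \<open>flat_gauge\<close> applies to it.\<close>

lemma kasteleyn_gauge:
  assumes "kasteleyn_orientation k \<phi>"
  shows "\<exists>s t. \<forall>(w, b) \<in> aztec_edges k. \<phi> (Inl w, Inr b) = s w * t b * aztec_sign w b"
proof -
  define e where "e = (\<lambda>w b. \<phi> (Inl w, Inr b) * aztec_sign w b)"
  have unit: "\<phi> (Inl w, Inr b) = 1 \<or> \<phi> (Inl w, Inr b) = -1" if "(w, b) \<in> aztec_edges k" for w b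
    using assms that unfolding kasteleyn_orientation_def by blast
  have sq: "aztec_sign w b * aztec_sign w b = 1" for w b
    by (cases "(w, b)" rule: aztec_sign.cases) (auto simp flip: power_mult_distrib)
  have sg: "aztec_sign w b = 1 \<or> aztec_sign w b = -1" for w b
    using sq[of w b] by (simp add: zmult_eq_1_iff)
  have eu: "e w b = 1 \<or> e w b = -1" if "(w, b) \<in> aztec_edges k" for w b
    using unit[OF that] sg[of w b] by (auto simp: e_def)
  have cyc: "cycle_edges [Inr b, Inl w, Inr b', Inl w'] = {(w, b), (w, b'), (w', b'), (w', b)}"
    "cycle_edges [Inl w, Inr b, Inl w', Inr b'] = {(w, b), (w', b), (w', b'), (w, b')}" for w b w' b'
    by (auto simp: cycle_edges_def)
  have kast: "(\<Prod>(w, b) \<in> cycle_edges f. \<phi> (Inl w, Inr b)) = -1" if "f \<in> aztec_faces k" for f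
  proof -
    have "length f = 2 * 2"
      using that by (auto simp: aztec_faces_def)
    then have "(\<Prod>(w, b) \<in> cycle_edges f. \<phi> (Inl w, Inr b)) = (-1) ^ (2 + 1)"
      using assms that unfolding kasteleyn_orientation_def by blast
    then show ?thesis by simp
  qed
  have four: "p * p' * (q * q') * (r * r') * (u * u') = 1"
    if "p * q * r * u = -1" "p' * q' * r' * u' = -1" for p q r u p' q' r' u' :: int
  proof -
    have "p * p' * (q * q') * (r * r') * (u * u') = (p * q * r * u) * (p' * q' * r' * u')"
      by (simp only: ac_simps)
    then show ?thesis using that by simp
  qed
  define A where "A = (\<lambda>i j. e (Face i j) (Bin i j))"
  define B where "B = (\<lambda>i j. e (Face i j) (Bin i (j + 1)))"
  define C where "C = (\<lambda>i j. e (Face (i + 1) j) (Bin i j))"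
  define D where "D = (\<lambda>i j. e (Face (i + 1) j) (Bin i (j + 1)))"
  have "\<exists>s t. \<forall>i<k. \<forall>j<k. A i j = s i j * t i j \<and> B i j = s i j * t i (j + 1) \<and>
      C i j = s (i + 1) j * t i j \<and> D i j = s (i + 1) j * t i (j + 1)"
  proof (rule flat_gauge, goal_cases)
    case (1 i j)
    then show ?case
      using eu[of "Face i j" "Bin i j"] eu[of "Face i j" "Bin i (j + 1)"]
        eu[of "Face (i + 1) j" "Bin i j"] eu[of "Face (i + 1) j" "Bin i (j + 1)"]
      unfolding A_def B_def C_def D_def by (simp add: aztec_edges_iff)
  next
    case (2 i j)
    then have "[Inr (Bin i j), Inl (Face (i + 1) j), Inr (Bin i (j + 1)), Inl (Face i j)] \<in> aztec_faces k"
      by (auto simp: aztec_faces_def)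
    from kast[OF this]
    have "\<phi> (Inl (Face i j), Inr (Bin i j)) * \<phi> (Inl (Face i j), Inr (Bin i (j + 1))) *
        \<phi> (Inl (Face (i + 1) j), Inr (Bin i j)) * \<phi> (Inl (Face (i + 1) j), Inr (Bin i (j + 1))) = -1"
      by (simp add: cyc ac_simps)
    moreover have "aztec_sign (Face i j) (Bin i j) * aztec_sign (Face i j) (Bin i (j + 1)) *
        aztec_sign (Face (i + 1) j) (Bin i j) * aztec_sign (Face (i + 1) j) (Bin i (j + 1)) = -1"
      by (cases "even j") auto
    ultimately show ?case
      unfolding A_def B_def C_def D_def e_def by (rule four)
  next
    case (3 i j)
    then have "[Inl (Face (i + 1) j), Inr (Bin (i + 1) (j + 1)), Inl (Face (i + 1) (j + 1)), Inr (Bin i (j + 1))]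
        \<in> aztec_faces k"
      by (auto simp: aztec_faces_def intro!: exI[of _ "i + 1"] exI[of _ "j + 1"])
    from kast[OF this]
    have "\<phi> (Inl (Face (i + 1) j), Inr (Bin (i + 1) (j + 1))) *
        \<phi> (Inl (Face (i + 1) (j + 1)), Inr (Bin (i + 1) (j + 1))) *
        \<phi> (Inl (Face (i + 1) (j + 1)), Inr (Bin i (j + 1))) *
        \<phi> (Inl (Face (i + 1) j), Inr (Bin i (j + 1))) = -1"
      by (simp add: cyc ac_simps)
    moreover have "aztec_sign (Face (i + 1) j) (Bin (i + 1) (j + 1)) *
        aztec_sign (Face (i + 1) (j + 1)) (Bin (i + 1) (j + 1)) *
        aztec_sign (Face (i + 1) (j + 1)) (Bin i (j + 1)) *
        aztec_sign (Face (i + 1) j) (Bin i (j + 1)) = -1"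
      by (cases "even j") auto
    ultimately show ?case
      unfolding A_def B_def C_def D_def e_def by (rule four)
  qed
  then obtain s t where st: "\<And>i j. i < k \<Longrightarrow> j < k \<Longrightarrow>
      A i j = s i j * t i j \<and> B i j = s i j * t i (j + 1) \<and>
      C i j = s (i + 1) j * t i j \<and> D i j = s (i + 1) j * t i (j + 1)"
    by blast
  \<comment> \<open>The values 0 at \<open>Broot\<close> and \<open>Btilde\<close> are never
    reached, since the black ends of Aztec edges are of the form \<open>Bin\<close>.\<close>
  define s' t' where "s' = case_face s" and "t' = case_bvertex 0 0 t"
  have "e w b = s' w * t' b" if edge: "(w, b) \<in> aztec_edges k" for w b
  proof -
    obtain i j i' j' where wb: "w = Face i j" "b = Bin i' j'" and ij: "i' < k" "j < k"
      and c: "i = i' \<or> i = i' + 1" "j' = j \<or> j' = j + 1"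
      using edge unfolding aztec_edges_iff by blast
    show ?thesis
      using st[OF ij] c wb by (auto simp: s'_def t'_def A_def B_def C_def D_def)
  qed
  then have "\<phi> (Inl w, Inr b) = s' w * t' b * aztec_sign w b" if "(w, b) \<in> aztec_edges k" for w b
    using that sq[of w b] by (metis e_def mult.assoc mult.right_neutral)
  then show ?thesis by blast
qed

subsection \<open>The partition function as a determinant\<close>

definition unravel :: "nat \<Rightarrow> nat \<Rightarrow> nat \<times> nat" where
  "unravel b m = (m div b, m mod b)"

lemma lex_less_unravel: "lex_less (unravel b x) (unravel b y) \<longleftrightarrow> x < y"
proof -
  have less: "x < y" if "x div b < y div b" for x y :: nat
    using that by (metis div_le_mono not_less)
  have "x mod b < y mod b \<longleftrightarrow> x < y" if "x div b = y div b"
    using that by (metis add_less_cancel_left mult_div_mod_eq)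
  then show ?thesis
    using less[of x y] less[of y x] by (auto simp: lex_less_def unravel_def not_less_iff_gr_or_eq)
qed

lemma bij_betw_unravel:
  assumes "b > 0"
  shows "bij_betw (unravel b) {0..<a * b} ({..<a} \<times> {..<b})"
proof (rule bij_betwI[where g = "\<lambda>(i, j). i * b + j"], goal_cases)
  case 2
  have "i * b + j < a * b" if "i < a" "j < b" for i j
  proof -
    have "i * b + j < Suc i * b" using that by simp
    also have "\<dots> \<le> a * b" using that by (intro mult_le_mono) auto
    finally show ?thesis .
  qed
  then show ?case by auto
qed (use assms in \<open>auto simp: unravel_def less_mult_imp_div_less\<close>)

definition white :: "nat \<Rightarrow> nat \<Rightarrow> face" where
  "white k m = case_prod Face (unravel k m)"

definition black :: "nat \<Rightarrow> nat \<Rightarrow> bvertex" where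
  "black k m = case_prod Bin (unravel (Suc k) m)"

lemma bij_betw_white:
  assumes "k \<ge> 1"
  shows "bij_betw (white k) {0..<k * (k + 1)} (faces k)"
proof -
  have "bij_betw (case_prod Face) ({..<Suc k} \<times> {..<k}) (faces k)"
    by (auto simp: bij_betw_def inj_on_def faces_def image_def)
  from bij_betw_trans[OF bij_betw_unravel[of k "Suc k"] this] show ?thesis
    using assms by (simp add: white_def[abs_def] comp_def mult.commute)
qed

lemma bij_betw_black: "bij_betw (black k) {0..<k * (k + 1)} (inner_blacks k)"
proof -
  have "bij_betw (case_prod Bin) ({..<k} \<times> {..<Suc k}) (inner_blacks k)"
    by (auto simp: bij_betw_def inj_on_def inner_blacks_def image_def)
  from bij_betw_trans[OF bij_betw_unravel[of "Suc k" k] this] show ?thesis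
    by (simp add: black_def[abs_def] comp_def)
qed

section \<open>Perfect matchings as permutations\<close>

definition matching_perms :: "nat \<Rightarrow> (nat \<Rightarrow> nat) set" where
  "matching_perms k = {p. p permutes {0..<k * (k + 1)} \<and>
     (\<forall>m < k * (k + 1). (white k m, black k (p m)) \<in> aztec_edges k)}"

text \<open>The numbering respects the lexicographic order, so the inversions of \<open>p\<close>
  correspond to \<open>pair_inversions\<close>. The exponents of \<open>aztec_sign\<close> add up to
  their number plus a constant, by \<open>card_pair_inversions\<close>.\<close>

lemma sign_matching_perm:
  assumes k: "k \<ge> 1" and "p \<in> matching_perms k"
  shows "(\<Prod>m = 0..<k * (k + 1). aztec_sign (white k m) (black k (p m))) =
    sign p * (-1) ^ ((\<Sum>i\<le>k. i choose 2) + (\<Sum>i<k. (k - i) choose 2))"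
proof -
  define n where "n = k * (k + 1)"
  have p: "p permutes {0..<n}"
    and edge: "\<And>m. m < n \<Longrightarrow> (white k m, black k (p m)) \<in> aztec_edges k"
    using assms by (auto simp: matching_perms_def n_def)
  define r where "r = inv_into UNIV p"
  have r: "p (r u) = u" "r (p u) = u" for u
    using permutes_inverses[OF p] by (simp_all add: r_def)
  have rp: "r permutes {0..<n}"
    unfolding r_def using p by (rule permutes_inv)
  have lt: "p m < n \<longleftrightarrow> m < n" "r m < n \<longleftrightarrow> m < n" for m
    using permutes_in_image[OF p, of m] permutes_in_image[OF rp, of m] by auto
  define \<sigma> where "\<sigma> = (\<lambda>(i, j). unravel (Suc k) (p (i * k + j)))"
  define \<tau> where "\<tau> = (\<lambda>(i, j). unravel k (r (i * Suc k + j)))"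
  have bw: "bij_betw (unravel k) {0..<n} ({..k} \<times> {..<k})"
    using bij_betw_unravel[of k "Suc k"] k by (simp add: n_def lessThan_Suc_atMost mult.commute)
  have bb: "bij_betw (unravel (Suc k)) {0..<n} ({..<k} \<times> {..k})"
    using bij_betw_unravel[of "Suc k" k] by (simp add: n_def lessThan_Suc_atMost)
  have \<sigma>_unravel: "\<sigma> (unravel k m) = unravel (Suc k) (p m)" for m
    by (simp add: \<sigma>_def unravel_def)
  have \<tau>_unravel: "\<tau> (unravel (Suc k) m) = unravel k (r m)" for m
    by (simp add: \<tau>_def unravel_def del: mult_Suc_right)
  have W: "\<exists>m<n. w = unravel k m" if "w \<in> {..k} \<times> {..<k}" for w
    using that unfolding bij_betw_imp_surj_on[OF bw, symmetric] by auto
  have B: "\<exists>m<n. b = unravel (Suc k) m" if "b \<in> {..<k} \<times> {..k}" for b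
    using that unfolding bij_betw_imp_surj_on[OF bb, symmetric] by auto
  have mem: "unravel k m \<in> {..k} \<times> {..<k}" "unravel (Suc k) m \<in> {..<k} \<times> {..k}" if "m < n" for m
    using bij_betwE[OF bw] bij_betwE[OF bb] that by auto
  interpret aztec_bijection k \<sigma> \<tau>
  proof
    fix w :: "nat \<times> nat" assume "w \<in> {..k} \<times> {..<k}"
    then obtain m where m: "m < n" "w = unravel k m" using W by blast
    show "\<sigma> w \<in> {..<k} \<times> {..k} \<and> \<tau> (\<sigma> w) = w"
      using m mem lt by (simp add: \<sigma>_unravel \<tau>_unravel r)
    show "(fst w = fst (\<sigma> w) \<or> fst w = fst (\<sigma> w) + 1) \<and> (snd (\<sigma> w) = snd w \<or> snd (\<sigma> w) = snd w + 1)"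
      using edge[OF m(1)] by (auto simp: m(2) \<sigma>_unravel aztec_edges_iff white_def black_def split: prod.splits)
  next
    fix b :: "nat \<times> nat" assume "b \<in> {..<k} \<times> {..k}"
    then obtain m where m: "m < n" "b = unravel (Suc k) m" using B by blast
    show "\<tau> b \<in> {..k} \<times> {..<k} \<and> \<sigma> (\<tau> b) = b"
      using m mem lt by (simp add: \<sigma>_unravel \<tau>_unravel r)
  qed
  have "bij_betw (map_prod (unravel k) (unravel k)) (inversions n p) pair_inversions"
  proof (rule bij_betw_imageI)
    show "inj_on (map_prod (unravel k) (unravel k)) (inversions n p)"
      using bij_betw_imp_inj_on[OF bw] by (auto simp: inj_on_def inversions_def)
    show "map_prod (unravel k) (unravel k) ` inversions n p = pair_inversions"
    proof (intro equalityI subsetI)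
      fix z assume "z \<in> map_prod (unravel k) (unravel k) ` inversions n p"
      then show "z \<in> pair_inversions"
        using mem(1) by (auto simp: inversions_def pair_inversions_def lex_less_unravel \<sigma>_unravel simp del: mem_Times_iff)
    next
      fix z assume z: "z \<in> pair_inversions"
      then obtain x y where xy: "z = (unravel k x, unravel k y)" "x < n" "y < n"
        using W unfolding pair_inversions_def by blast
      then have "(x, y) \<in> inversions n p"
        using z by (simp add: pair_inversions_def inversions_def lex_less_unravel \<sigma>_unravel)
      then show "z \<in> map_prod (unravel k) (unravel k) ` inversions n p"
        using xy by (auto intro: image_eqI[of _ _ "(x, y)"])
    qed
  qed
  then have card: "card (inversions n p) = card pair_inversions"
    by (rule bij_betw_same_card)
  have "(\<Prod>m = 0..<n. aztec_sign (white k m) (black k (p m))) = (\<Prod>m = 0..<n. (-1) ^ exponent (unravel k m))"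
    by (rule prod.cong) (auto simp: white_def black_def exponent_def \<sigma>_unravel split: prod.splits)
  also have "\<dots> = (-1) ^ (\<Sum>m = 0..<n. exponent (unravel k m))"
    by (simp add: power_sum)
  also have "(\<Sum>m = 0..<n. exponent (unravel k m)) = (\<Sum>w \<in> {..k} \<times> {..<k}. exponent w)"
    by (rule sum.reindex_bij_betw[OF bw])
  finally show ?thesis
    unfolding card_pair_inversions[symmetric] n_def[symmetric] sign_eq_inversions[OF p] card
    by (simp add: power_add)
qed

lemma bij_betw_matching_perms:
  assumes "k \<ge> 1"
  shows "bij_betw (\<lambda>p. (\<lambda>m. (white k m, black k (p m))) ` {0..<k * (k + 1)}) (matching_perms k) (perfect_matchings k)"
proof -
  define n where "n = k * (k + 1)"
  have w: "bij_betw (white k) {0..<n} (faces k)" and b: "bij_betw (black k) {0..<n} (inner_blacks k)"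
    unfolding n_def by (rule bij_betw_white[OF assms], rule bij_betw_black)
  have w_inj: "white k x = white k y \<longleftrightarrow> x = y" if "x < n" "y < n" for x y
    using w that by (auto simp: bij_betw_def inj_on_def)
  have b_inj: "black k x = black k y \<longleftrightarrow> x = y" if "x < n" "y < n" for x y
    using b that by (auto simp: bij_betw_def inj_on_def)
  have w_ex: "\<exists>x<n. w = white k x" if "w \<in> faces k" for w
    using that unfolding bij_betw_imp_surj_on[OF w, symmetric] by auto
  have b_ex: "\<exists>x<n. b = black k x" if "b \<in> inner_blacks k" for b
    using that unfolding bij_betw_imp_surj_on[OF b, symmetric] by auto
  have w_in: "white k x \<in> faces k" and b_in: "black k x \<in> inner_blacks k" if "x < n" for x
    using bij_betwE[OF w] bij_betwE[OF b] that by auto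
  define G where "G = (\<lambda>p. (\<lambda>m. (white k m, black k (p m))) ` {0..<n})"
  have G_iff: "(white k x, black k y) \<in> G p \<longleftrightarrow> y = p x"
    if "p permutes {0..<n}" "x < n" "y < n" for p x y
    using that permutes_in_image[OF that(1), of x] by (auto simp: G_def w_inj b_inj)
  have "bij_betw G (matching_perms k) (perfect_matchings k)"
  proof (rule bij_betw_imageI)
    show "inj_on G (matching_perms k)"
    proof (rule inj_onI)
      fix p q assume pq: "p \<in> matching_perms k" "q \<in> matching_perms k" "G p = G q"
      then have perm: "p permutes {0..<n}" "q permutes {0..<n}"
        by (auto simp: matching_perms_def n_def)
      show "p = q"
      proof
        fix x
        show "p x = q x"
        proof (cases "x < n")
          case True
          then have "p x < n" using permutes_in_image[OF perm(1), of x] by simp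
          then show ?thesis
            using G_iff[OF perm(1) True] G_iff[OF perm(2) True] pq(3) by blast
        next
          case False
          then show ?thesis using perm by (simp add: permutes_def)
        qed
      qed
    qed
    show "G ` matching_perms k = perfect_matchings k"
    proof (intro equalityI subsetI)
      fix M assume "M \<in> G ` matching_perms k"
      then obtain p where p: "M = G p" "p permutes {0..<n}"
          and edge: "\<And>m. m < n \<Longrightarrow> (white k m, black k (p m)) \<in> aztec_edges k"
        by (auto simp: matching_perms_def n_def)
      have lt: "p x < n" if "x < n" for x
        using permutes_in_image[OF p(2), of x] that by simp
      have "\<exists>!b. (w, b) \<in> M" if "w \<in> faces k" for w
      proof -
        obtain x where x: "x < n" "w = white k x" using w_ex[OF \<open>w \<in> faces k\<close>] by blast
        show ?thesis
          by (rule ex1I[of _ "black k (p x)"]) (use x lt in \<open>auto simp: p(1) G_def w_inj\<close>)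
      qed
      moreover have "\<exists>!w. (w, b) \<in> M" if "b \<in> inner_blacks k" for b
      proof -
        obtain y where y: "y < n" "b = black k y" using b_ex[OF \<open>b \<in> inner_blacks k\<close>] by blast
        then obtain x where x: "y = p x" "x < n"
          using permutes_image[OF p(2)] by (metis atLeastLessThan_iff imageE zero_le)
        show ?thesis
          by (rule ex1I[of _ "white k x"])
            (use x y lt permutes_inj[OF p(2)] in \<open>auto simp: p(1) G_def b_inj inj_eq\<close>)
      qed
      moreover have "M \<subseteq> aztec_edges k"
        using edge by (auto simp: p(1) G_def)
      ultimately show "M \<in> perfect_matchings k"
        by (simp add: perfect_matchings_def)
    next
      fix M assume M: "M \<in> perfect_matchings k"
      then have sub: "M \<subseteq> aztec_edges k"
        and ex_b: "\<And>w. w \<in> faces k \<Longrightarrow> \<exists>!b. (w, b) \<in> M"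
        and ex_w: "\<And>b. b \<in> inner_blacks k \<Longrightarrow> \<exists>!w. (w, b) \<in> M"
        by (auto simp: perfect_matchings_def)
      have in_B: "b \<in> inner_blacks k" and in_W: "w \<in> faces k" if "(w, b) \<in> M" for w b
        using sub that aztec_edges_subset by blast+
      \<comment> \<open>The number of the partner of face \<open>x\<close>; outside the range
        \<open>p\<close> is the identity, as \<open>permutes\<close> demands.\<close>
      define p where "p = (\<lambda>x. if x < n then (THE y. y < n \<and> (white k x, black k y) \<in> M) else x)"
      have pM: "p x < n \<and> (white k x, black k (p x)) \<in> M" if "x < n" for x
      proof -
        have "\<exists>!y. y < n \<and> (white k x, black k y) \<in> M"
          using ex_b[OF w_in[OF that]] b_ex in_B b_inj by metis
        from theI'[OF this] show ?thesis using that by (simp add: p_def)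
      qed
      have "inj_on p {0..<n}"
      proof (rule inj_onI)
        fix x y assume "x \<in> {0..<n}" "y \<in> {0..<n}" "p x = p y"
        then show "x = y"
          using pM[of x] pM[of y] ex_w[OF b_in[of "p x"]] w_inj by auto
      qed
      moreover have "p ` {0..<n} \<subseteq> {0..<n}"
        using pM by auto
      ultimately have "bij_betw p {0..<n} {0..<n}"
        by (simp add: bij_betw_def endo_inj_surj)
      then have perm: "p permutes {0..<n}"
        by (rule bij_imp_permutes) (simp add: p_def)
      have "G p = M"
      proof (intro equalityI subsetI)
        fix z assume z: "z \<in> M"
        obtain w b where [simp]: "z = (w, b)" by fastforce
        obtain x where x: "x < n" "w = white k x" using z in_W[of w b] w_ex by auto
        then have "b = black k (p x)"
          using z pM[OF x(1)] ex_b[OF w_in[OF x(1)]] by auto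
        then show "z \<in> G p" using x by (auto simp: G_def)
      qed (use pM in \<open>auto simp: G_def\<close>)
      moreover have "p \<in> matching_perms k"
        using perm pM sub by (auto simp: matching_perms_def n_def)
      ultimately show "M \<in> G ` matching_perms k" by blast
    qed
  qed
  then show ?thesis by (simp only: G_def n_def)
qed

section \<open>The unsigned Kasteleyn matrix\<close>

definition face_weight :: "nat \<Rightarrow> (bedge \<Rightarrow> complex) \<Rightarrow> face \<Rightarrow> bvertex \<Rightarrow> complex" where
  "face_weight k a w b = (if (w, b) \<in> aztec_edges k then a (prev_edge k w b) - a (next_edge k w b) else 0)"

definition kasteleyn_mat :: "nat \<Rightarrow> (bedge \<Rightarrow> complex) \<Rightarrow> complex mat" where
  "kasteleyn_mat k a = mat (k * (k + 1)) (k * (k + 1)) (\<lambda>(x, y). face_weight k a (white k x) (black k y))"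

text \<open>The gauge factors \<open>s\<close> and \<open>t\<close> have the same product over every
  perfect matching, and \<open>aztec_sign\<close> contributes the sign of the permutation up to a
  constant. What remains is the Leibniz expansion, and the constant is chosen before
  \<open>a\<close>.\<close>

lemma partition_function_eq_det:
  assumes k: "k \<ge> 1" and "kasteleyn_orientation k \<phi>"
  shows "\<exists>c. \<forall>a. partition_function k a \<phi> = c * det (kasteleyn_mat k a)"
proof -
  define n where "n = k * (k + 1)"
  obtain s t where st: "\<And>w b. (w, b) \<in> aztec_edges k \<Longrightarrow> \<phi> (Inl w, Inr b) = s w * t b * aztec_sign w b"
    using kasteleyn_gauge[OF assms(2)] by blast
  define e :: nat where "e = (\<Sum>i\<le>k. i choose 2) + (\<Sum>i<k. (k - i) choose 2)"
  define c where "c = (\<Prod>m = 0..<n. s (white k m)) * (\<Prod>m = 0..<n. t (black k m)) * (-1) ^ e"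
  have white_inj: "inj_on (white k) {0..<n}"
    unfolding n_def by (rule bij_betw_imp_inj_on[OF bij_betw_white[OF k]])
  have inj: "inj_on (\<lambda>m. (white k m, f m)) {0..<n}" for f :: "nat \<Rightarrow> bvertex"
    by (rule inj_onI) (blast dest: inj_onD[OF white_inj])
  have \<phi>: "(\<Prod>m = 0..<n. \<phi> (Inl (white k m), Inr (black k (p m)))) = c * sign p"
    if p: "p \<in> matching_perms k" for p
  proof -
    have "p permutes {0..<n}" using p by (simp add: matching_perms_def n_def)
    then have "(\<Prod>m = 0..<n. t (black k (p m))) = (\<Prod>m = 0..<n. t (black k m))"
      using prod.permute[of p "{0..<n}" "\<lambda>m. t (black k m)"] by (simp add: comp_def)
    moreover have "(\<Prod>m = 0..<n. \<phi> (Inl (white k m), Inr (black k (p m)))) =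
        (\<Prod>m = 0..<n. s (white k m) * t (black k (p m)) * aztec_sign (white k m) (black k (p m)))"
      by (rule prod.cong) (use p st in \<open>auto simp: matching_perms_def n_def\<close>)
    ultimately show ?thesis
      using sign_matching_perm[OF k p] by (simp add: prod.distrib c_def e_def n_def)
  qed
  have "partition_function k a \<phi> = of_int c * det (kasteleyn_mat k a)" for a
  proof -
    let ?K = "\<lambda>p. \<Prod>m = 0..<n. kasteleyn_mat k a $$ (m, p m)"
    have entry: "kasteleyn_mat k a $$ (m, p m) = face_weight k a (white k m) (black k (p m))"
      if "p permutes {0..<n}" "m < n" for m p
      using permutes_in_image[OF that(1), of m] that by (simp add: kasteleyn_mat_def n_def)
    have "partition_function k a \<phi> = (\<Sum>p \<in> matching_perms k.
        \<Prod>(w, b) \<in> (\<lambda>m. (white k m, black k (p m))) ` {0..<n}.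
        of_int (\<phi> (Inl w, Inr b)) * (a (prev_edge k w b) - a (next_edge k w b)))"
      unfolding partition_function_def n_def
      by (rule sum.reindex_bij_betw[OF bij_betw_matching_perms[OF k], symmetric])
    also have "\<dots> = (\<Sum>p \<in> matching_perms k. of_int c * (of_int (sign p) * ?K p))"
    proof (rule sum.cong)
      fix p assume p: "p \<in> matching_perms k"
      then have perm: "p permutes {0..<n}" by (simp add: matching_perms_def n_def)
      have "(\<Prod>(w, b) \<in> (\<lambda>m. (white k m, black k (p m))) ` {0..<n}.
          of_int (\<phi> (Inl w, Inr b)) * (a (prev_edge k w b) - a (next_edge k w b))) =
        (\<Prod>m = 0..<n. of_int (\<phi> (Inl (white k m), Inr (black k (p m)))) * kasteleyn_mat k a $$ (m, p m))"
        by (subst prod.reindex[OF inj], rule prod.cong)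
          (use p entry[OF perm] in \<open>auto simp: matching_perms_def n_def face_weight_def\<close>)
      also have "\<dots> = of_int (\<Prod>m = 0..<n. \<phi> (Inl (white k m), Inr (black k (p m)))) * ?K p"
        by (simp add: prod.distrib)
      finally show "(\<Prod>(w, b) \<in> (\<lambda>m. (white k m, black k (p m))) ` {0..<n}.
          of_int (\<phi> (Inl w, Inr b)) * (a (prev_edge k w b) - a (next_edge k w b))) =
          of_int c * (of_int (sign p) * ?K p)"
        by (simp only: \<phi>[OF p]) simp
    qed simp
    also have "\<dots> = of_int c * (\<Sum>p \<in> matching_perms k. of_int (sign p) * ?K p)"
      by (simp add: sum_distrib_left)
    \<comment> \<open>A permutation that is not a matching uses a non-adjacent pair, whose matrix
      entry is 0.\<close>
    also have "(\<Sum>p \<in> matching_perms k. of_int (sign p) * ?K p) =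
        (\<Sum>p \<in> {p. p permutes {0..<n}}. of_int (sign p) * ?K p)"
    proof (rule sum.mono_neutral_left)
      show "\<forall>p \<in> {p. p permutes {0..<n}} - matching_perms k. of_int (sign p) * ?K p = 0"
      proof
        fix p assume p: "p \<in> {p. p permutes {0..<n}} - matching_perms k"
        then obtain m where "m < n" "(white k m, black k (p m)) \<notin> aztec_edges k"
          by (auto simp: matching_perms_def n_def)
        then have "\<exists>m \<in> {0..<n}. kasteleyn_mat k a $$ (m, p m) = 0"
          using p entry[of p m] by (auto simp: face_weight_def)
        then show "of_int (sign p) * ?K p = 0"
          by (simp add: prod_zero)
      qed
    qed (auto simp: finite_permutations matching_perms_def n_def)
    also have "\<dots> = det (kasteleyn_mat k a)"
      by (subst det_def'[of _ n]) (auto simp: kasteleyn_mat_def n_def)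
    finally show ?thesis .
  qed
  then show ?thesis by blast
qed

subsection \<open>Flows and circulations\<close>

text \<open>The sign with which the counterclockwise boundary of a face traverses an edge.\<close>

fun circulation :: "bedge \<Rightarrow> face \<Rightarrow> complex" where
  "circulation \<epsilon> (Face i j) = of_bool (\<epsilon> = Hor i j) - of_bool (\<epsilon> = Hor i (j + 1)) + of_bool (\<epsilon> = Ver i j)
     - of_bool (0 < i \<and> \<epsilon> = Ver (i - 1) j)"

lemma finite_edges: "finite (edges k)"
  by (rule card_ge_0_finite) (simp add: card_edges)

lemma Hor_in_edges [simp]: "Hor i j \<in> edges k \<longleftrightarrow> i \<le> k \<and> j \<le> k"
  and Ver_in_edges [simp]: "Ver i j \<in> edges k \<longleftrightarrow> i < k \<and> j < k"
  by (auto simp: edges_def)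

lemma sum_edges_of_bool:
  fixes g :: "bedge \<Rightarrow> complex"
  shows "(\<Sum>\<epsilon> \<in> edges k. g \<epsilon> * of_bool (P \<and> \<epsilon> = e)) = (if P \<and> e \<in> edges k then g e else 0)"
    and "(\<Sum>\<epsilon> \<in> edges k. g \<epsilon> * of_bool (\<epsilon> = e)) = (if e \<in> edges k then g e else 0)"
proof -
  show "(\<Sum>\<epsilon> \<in> edges k. g \<epsilon> * of_bool (\<epsilon> = e)) = (if e \<in> edges k then g e else 0)"
    by (simp add: of_bool_def if_distrib[where f = "(*) _"] finite_edges cong: if_cong)
  then show "(\<Sum>\<epsilon> \<in> edges k. g \<epsilon> * of_bool (P \<and> \<epsilon> = e)) = (if P \<and> e \<in> edges k then g e else 0)"
    by (cases P) simp_all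
qed

lemma sum_circulation:
  assumes "i \<le> k" "j < k"
  shows "(\<Sum>\<epsilon> \<in> edges k. g \<epsilon> * circulation \<epsilon> (Face i j)) =
    g (Hor i j) - g (Hor i (j + 1)) + (if i < k then g (Ver i j) else 0) - (if 0 < i then g (Ver (i - 1) j) else 0)"
proof -
  have "(\<Sum>\<epsilon> \<in> edges k. g \<epsilon> * circulation \<epsilon> (Face i j)) =
      (\<Sum>\<epsilon> \<in> edges k. g \<epsilon> * of_bool (\<epsilon> = Hor i j)) - (\<Sum>\<epsilon> \<in> edges k. g \<epsilon> * of_bool (\<epsilon> = Hor i (j + 1)))
      + (\<Sum>\<epsilon> \<in> edges k. g \<epsilon> * of_bool (\<epsilon> = Ver i j))
      - (\<Sum>\<epsilon> \<in> edges k. g \<epsilon> * of_bool (0 < i \<and> \<epsilon> = Ver (i - 1) j))"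
    by (simp only: circulation.simps ring_distribs sum.distrib sum_subtractf)
  \<comment> \<open>At \<open>i = k\<close> the edge \<open>Ver k j\<close> drops out because it is
    not in \<open>edges k\<close>. At \<open>i = 0\<close> the guard is needed, as the truncated
    \<open>i - 1\<close> would yield \<open>Ver 0 j\<close>.\<close>
  then show ?thesis
    unfolding sum_edges_of_bool using assms by auto
qed

lemma face_weight_corners:
  assumes "i < k" "j < k"
  shows "face_weight k a (Face i j) (Bin i j) = a (Hor i j) - a (Ver i j)"
    and "face_weight k a (Face i j) (Bin i (j + 1)) = a (Ver i j) - a (Hor i (j + 1))"
    and "face_weight k a (Face (i + 1) j) (Bin i (j + 1)) = a (Hor (i + 1) (j + 1)) - a (Ver i j)"
    and "face_weight k a (Face (i + 1) j) (Bin i j) = a (Ver i j) - a (Hor (i + 1) j)"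
  using assms by (auto simp: face_weight_def aztec_edges_iff next_edge_def prev_edge_def bpt_def)

lemma face_weight_eq_0: "(w, b) \<notin> aztec_edges k \<Longrightarrow> face_weight k a w b = 0"
  by (simp add: face_weight_def)

section \<open>Pairing incidence columns with face boundaries\<close>

lemma C_mat_Hor:
  "i' < k \<Longrightarrow> C_mat k a (Hor i j) (Bin i' j') =
     a (Hor i j) * (of_bool (i = i' \<and> j = j') - of_bool (i = i' + 1 \<and> j = j'))"
  by (cases i) (auto simp: C_mat_def bpt_def)

lemma C_mat_Ver:
  "C_mat k a (Ver i j) (Bin i' j') = a (Ver i j) * (of_bool (i = i' \<and> j' = j + 1) - of_bool (i = i' \<and> j' = j))"
  by (auto simp: C_mat_def)

text \<open>At a corner \<open>b\<close> the counterclockwise walk enters along the previous edge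
  and leaves along the next one; the two orientation signs combine to \<open>+\<close> for entering
  and \<open>-\<close> for leaving. If \<open>b\<close> is not a corner, no edge of the walk touches
  it.\<close>

lemma sum_C_mat_circulation:
  assumes w: "w \<in> faces k" and b: "b \<in> inner_blacks k"
  shows "(\<Sum>\<epsilon> \<in> edges k. C_mat k a \<epsilon> b * circulation \<epsilon> w) = face_weight k a w b"
proof -
  obtain i j where w: "w = Face i j" "i \<le> k" "j < k" using w by (auto simp: faces_def)
  obtain i' j' where b: "b = Bin i' j'" "i' < k" "j' \<le> k" using b by (auto simp: inner_blacks_def)
  note C = sum_circulation[OF w(2,3)] C_mat_Hor[OF b(2)] C_mat_Ver
  consider "i = i'" "j' = j" | "i = i'" "j' = j + 1" | "i = i' + 1" "j' = j" | "i = i' + 1" "j' = j + 1"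
    | (other) "(w, b) \<notin> aztec_edges k"
    using w b by (auto simp: aztec_edges_iff)
  then show ?thesis
  proof cases
    case 1
    then show ?thesis
      unfolding w(1) b(1) C using face_weight_corners(1)[OF b(2) w(3)] b(2) by auto
  next
    case 2
    then show ?thesis
      unfolding w(1) b(1) C using face_weight_corners(2)[OF b(2) w(3)] b(2) by auto
  next
    case 3
    then show ?thesis
      unfolding w(1) b(1) C using face_weight_corners(4)[OF b(2) w(3)] b(2) by auto
  next
    case 4
    then show ?thesis
      unfolding w(1) b(1) C using face_weight_corners(3)[OF b(2) w(3)] b(2) by auto
  next
    case other
    then have "\<not> ((i = i' \<or> i = i' + 1) \<and> (j' = j \<or> j' = j + 1))"
      using w b by (auto simp: aztec_edges_iff)
    then show ?thesis
      unfolding face_weight_eq_0[OF other] unfolding w(1) b(1) C by auto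
  qed
qed

text \<open>The column of \<open>C_mat k (\<lambda>_. 1)\<close> at \<open>Btilde\<close>, which is
  the right end of exactly the edges \<open>Hor k j\<close>.\<close>

fun last_column :: "nat \<Rightarrow> bedge \<Rightarrow> complex" where
  "last_column k (Hor i j) = of_bool (i = k)"
| "last_column k (Ver i j) = 0"

lemma sum_last_column: "(\<Sum>\<epsilon> \<in> edges k. last_column k \<epsilon> * g \<epsilon>) = (\<Sum>j = 0..k. g (Hor k j))"
proof -
  have "(\<Sum>\<epsilon> \<in> edges k. last_column k \<epsilon> * g \<epsilon>) = (\<Sum>\<epsilon> \<in> Hor k ` {0..k}. last_column k \<epsilon> * g \<epsilon>)"
  proof (rule sum.mono_neutral_right)
    show "\<forall>\<epsilon> \<in> edges k - Hor k ` {0..k}. last_column k \<epsilon> * g \<epsilon> = 0"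
      by (auto simp: edges_def)
  qed (auto simp: finite_edges)
  also have "\<dots> = (\<Sum>j = 0..k. g (Hor k j))"
    by (subst sum.reindex) (auto simp: inj_on_def)
  finally show ?thesis .
qed

text \<open>A face with \<open>i = k\<close> traverses \<open>Hor k j\<close> forwards and
  \<open>Hor k (j + 1)\<close> backwards; the other faces have no edge at
  \<open>Btilde\<close>.\<close>

lemma sum_last_column_circulation:
  assumes "w \<in> faces k"
  shows "(\<Sum>\<epsilon> \<in> edges k. last_column k \<epsilon> * circulation \<epsilon> w) = 0"
proof -
  obtain i j where w: "w = Face i j" "i \<le> k" "j < k" using assms by (auto simp: faces_def)
  show ?thesis
    unfolding w(1) sum_circulation[OF w(2,3)] by simp
qed

lemma sum_C_mat_one:
  assumes "i < k" "j \<le> k"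
  shows "(\<Sum>\<epsilon> \<in> edges k. C_mat k (\<lambda>_. 1) \<epsilon> (Bin i j) * g \<epsilon>) =
    g (Hor i j) - g (Hor (i + 1) j) + (if 0 < j then g (Ver i (j - 1)) else 0) - (if j < k then g (Ver i j) else 0)"
proof -
  have "C_mat k (\<lambda>_. 1) \<epsilon> (Bin i j) * g \<epsilon> = g \<epsilon> * of_bool (\<epsilon> = Hor i j) - g \<epsilon> * of_bool (\<epsilon> = Hor (i + 1) j)
      + g \<epsilon> * of_bool (0 < j \<and> \<epsilon> = Ver i (j - 1)) - g \<epsilon> * of_bool (\<epsilon> = Ver i j)" for \<epsilon>
    using assms by (cases \<epsilon>) (auto simp: C_mat_Hor C_mat_Ver)
  then have "(\<Sum>\<epsilon> \<in> edges k. C_mat k (\<lambda>_. 1) \<epsilon> (Bin i j) * g \<epsilon>) =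
      (\<Sum>\<epsilon> \<in> edges k. g \<epsilon> * of_bool (\<epsilon> = Hor i j)) - (\<Sum>\<epsilon> \<in> edges k. g \<epsilon> * of_bool (\<epsilon> = Hor (i + 1) j))
      + (\<Sum>\<epsilon> \<in> edges k. g \<epsilon> * of_bool (0 < j \<and> \<epsilon> = Ver i (j - 1)))
      - (\<Sum>\<epsilon> \<in> edges k. g \<epsilon> * of_bool (\<epsilon> = Ver i j))"
    by (simp only: sum.distrib sum_subtractf)
  then show ?thesis
    unfolding sum_edges_of_bool using assms by auto
qed

text \<open>A spanning tree of \<open>G\<^sup>\<bullet>\<close>.\<close>

definition tree :: "nat \<Rightarrow> bedge set" where
  "tree k = insert (Hor k 0) {Hor i j | i j. i < k \<and> j \<le> k}"

lemma card_tree: "card (tree k) = k * (k + 1) + 1"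
proof -
  have "{Hor i j | i j. i < k \<and> j \<le> k} = (\<lambda>(i, j). Hor i j) ` ({..<k} \<times> {..k})"
    by auto
  moreover have "card ((\<lambda>(i, j). Hor i j) ` ({..<k} \<times> {..k})) = k * (k + 1)"
    by (subst card_image) (auto simp: inj_on_def)
  moreover have "Hor k 0 \<notin> {Hor i j | i j. i < k \<and> j \<le> k}"
    by simp
  ultimately show ?thesis
    by (simp add: tree_def card_insert_if del: mem_Collect_eq)
qed

lemma tree_subset: "tree k \<subseteq> edges k"
  by (auto simp: tree_def)

text \<open>The relations of the faces, taken from left to right, kill the vertical edges column by
  column. In the last column they then carry the zero at \<open>Hor k 0\<close> upwards. This makes
  tree indicators and face boundaries independent.\<close>

lemma closed_zero_on_tree:
  assumes tree: "\<And>\<epsilon>. \<epsilon> \<in> tree k \<Longrightarrow> g \<epsilon> = 0"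
    and closed: "\<And>w. w \<in> faces k \<Longrightarrow> (\<Sum>\<epsilon> \<in> edges k. g \<epsilon> * circulation \<epsilon> w) = 0"
    and "\<epsilon> \<in> edges k"
  shows "g \<epsilon> = 0"
proof -
  have hor: "g (Hor i j) = 0" if "i < k" "j \<le> k" for i j
    using tree[of "Hor i j"] that by (simp add: tree_def)
  have face: "g (Hor i j) - g (Hor i (j + 1)) + (if i < k then g (Ver i j) else 0)
      - (if 0 < i then g (Ver (i - 1) j) else 0) = 0" if "i \<le> k" "j < k" for i j
    using closed[of "Face i j"] that by (simp only: sum_circulation) (simp add: faces_def)
  have ver: "g (Ver i j) = 0" if "i < k" "j < k" for i j
    using that
  proof (induction i)
    case 0
    then show ?case using face[of 0 j] hor[of 0 j] hor[of 0 "j + 1"] by simp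
  next
    case (Suc i)
    then show ?case using face[of "Suc i" j] hor[of "Suc i" j] hor[of "Suc i" "j + 1"] by simp
  qed
  have "g (Hor k j) = 0" if "j \<le> k" for j
    using that
  proof (induction j)
    case 0
    show ?case by (rule tree) (simp add: tree_def)
  next
    case (Suc j)
    then show ?case using face[of k j] ver[of "k - 1" j] by simp
  qed
  then show ?thesis
    using assms(3) hor ver by (auto simp: edges_def nat_less_le)
qed

text \<open>The total at \<open>Btilde\<close> is carried by \<open>Hor k 0\<close> alone, so it
  vanishes there; conservation at the inner vertices then moves the zero leftwards along every
  row.\<close>

lemma flow_zero_off_tree:
  assumes off_tree: "\<And>\<epsilon>. \<epsilon> \<in> edges k - tree k \<Longrightarrow> g \<epsilon> = 0"
    and total: "(\<Sum>\<epsilon> \<in> edges k. last_column k \<epsilon> * g \<epsilon>) = 0"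
    and flow: "\<And>b. b \<in> inner_blacks k \<Longrightarrow> (\<Sum>\<epsilon> \<in> edges k. C_mat k (\<lambda>_. 1) \<epsilon> b * g \<epsilon>) = 0"
    and "\<epsilon> \<in> edges k"
  shows "g \<epsilon> = 0"
proof -
  have ver: "g (Ver i j) = 0" if "i < k" "j < k" for i j
    using that by (intro off_tree) (simp add: tree_def)
  have last: "g (Hor k j) = 0" if "0 < j" "j \<le> k" for j
    using that by (intro off_tree) (simp add: tree_def)
  have "(\<Sum>j = 0..k. g (Hor k j)) = g (Hor k 0) + (\<Sum>j = Suc 0..k. g (Hor k j))"
    by (rule sum.atLeast_Suc_atMost) simp
  also have "(\<Sum>j = Suc 0..k. g (Hor k j)) = 0"
    using last by (intro sum.neutral) auto
  finally have "g (Hor k 0) = 0"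
    using total by (simp add: sum_last_column)
  with last have last': "g (Hor k j) = 0" if "j \<le> k" for j
    using that by (cases j) auto
  have step: "g (Hor i j) = g (Hor (i + 1) j)" if "i < k" "j \<le> k" for i j
    using flow[of "Bin i j"] that ver[of i "j - 1"] ver[of i j]
    by (simp only: sum_C_mat_one) (auto simp: inner_blacks_def split: if_splits)
  have "g (Hor i j) = 0" if "i \<le> k" "j \<le> k" for i j
    using that(1)
  proof (induction i rule: inc_induct)
    case base
    show ?case using last'[OF that(2)] .
  next
    case (step i)
    then show ?case using \<open>\<And>i j. i < k \<Longrightarrow> j \<le> k \<Longrightarrow> g (Hor i j) = g (Hor (i + 1) j)\<close>[of i j] that(2) by simp
  qed
  then show ?thesis
    using assms(4) ver by (auto simp: edges_def)
qed

subsection \<open>The bordered determinant\<close>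

text \<open>Tree edges come first, so that the matrices split at index \<open>n + 1\<close>; the
  number of edges is \<open>(k + 1)\<^sup>2 + k\<^sup>2 = 2 * n + 1\<close>.\<close>

locale edge_enumeration =
  fixes k n :: nat and f :: "nat \<Rightarrow> bedge"
  defines "n \<equiv> k * (k + 1)"
  assumes k: "k \<ge> 1"
    and f: "bij_betw f {0..<2 * n + 1} (edges k)"
    and f_tree: "bij_betw f {0..<n + 1} (tree k)"
begin

text \<open>The transpose of the matrix called $(r \mid C(a)^B \mid C(b)^B)$ above.\<close>

definition flow_mat :: "(bedge \<Rightarrow> complex) \<Rightarrow> (bedge \<Rightarrow> complex) \<Rightarrow> (bedge \<Rightarrow> complex) \<Rightarrow> complex mat" where
  "flow_mat r a b = mat (2 * n + 1) (2 * n + 1) (\<lambda>(i, m).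
     if i = 0 then r (f m)
     else if i < n + 1 then C_mat k a (f m) (black k (i - 1))
     else C_mat k b (f m) (black k (i - (n + 1))))"

lemma flow_mat_carrier [simp]: "flow_mat r a b \<in> carrier_mat (2 * n + 1) (2 * n + 1)"
  by (simp add: flow_mat_def)

lemma sum_f: "(\<Sum>m = 0..<2 * n + 1. g (f m)) = (\<Sum>\<epsilon> \<in> edges k. g \<epsilon>)"
  by (rule sum.reindex_bij_betw[OF f])

lemma black_in: "m < n \<Longrightarrow> black k m \<in> inner_blacks k"
  using bij_betwE[OF bij_betw_black[of k]] by (auto simp: n_def)

lemma black_surj:
  assumes "b \<in> inner_blacks k"
  obtains m where "m < n" "b = black k m"
  using assms unfolding bij_betw_imp_surj_on[OF bij_betw_black, symmetric] by (auto simp: n_def)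

lemma white_in: "m < n \<Longrightarrow> white k m \<in> faces k"
  using bij_betwE[OF bij_betw_white[OF k]] by (auto simp: n_def)

lemma white_surj:
  assumes "w \<in> faces k"
  obtains m where "m < n" "w = white k m"
  using assms unfolding bij_betw_imp_surj_on[OF bij_betw_white[OF k], symmetric] by (auto simp: n_def)

definition f_inv :: "bedge \<Rightarrow> nat" where
  "f_inv = inv_into {0..<2 * n + 1} f"

lemma f_inv_f: "m < 2 * n + 1 \<Longrightarrow> f_inv (f m) = m"
  unfolding f_inv_def using bij_betw_inv_into_left[OF f] by simp

lemma f_in: "m < 2 * n + 1 \<Longrightarrow> f m \<in> edges k"
  using bij_betwE[OF f] by auto

lemma f_in_tree: "m < n + 1 \<Longrightarrow> f m \<in> tree k"
  using bij_betwE[OF f_tree] by auto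

lemma f_inv_tree: "\<epsilon> \<in> tree k \<Longrightarrow> f_inv \<epsilon> < n + 1"
  unfolding bij_betw_imp_surj_on[OF f_tree, symmetric] using f_inv_f by auto

lemma f_notin_tree:
  assumes "n + 1 \<le> m" "m < 2 * n + 1"
  shows "f m \<notin> tree k"
  using f_inv_f[of m] f_inv_tree[of "f m"] assms by auto

text \<open>Multiplication by this matrix makes \<open>flow_mat\<close> block triangular: face boundaries are orthogonal to
  all rows of the latter that do not involve the weights.\<close>

definition cycle_mat :: "complex mat" where
  "cycle_mat = mat (2 * n + 1) (2 * n + 1) (\<lambda>(m, c).
     if c < n + 1 then of_bool (m = c) else circulation (f m) (white k (c - (n + 1))))"

text \<open>The incidence matrix of the spanning tree with the vertex \<open>Broot\<close> left
  out.\<close>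

definition tree_mat :: "complex mat" where
  "tree_mat = mat (n + 1) (n + 1) (\<lambda>(i, c). flow_mat (last_column k) (\<lambda>_. 1) (\<lambda>_. 1) $$ (i, c))"

text \<open>A kernel vector of the transpose, read as a function on edges, vanishes on the tree and
  is orthogonal to all face boundaries, hence is zero by \<open>closed_zero_on_tree\<close>.\<close>

lemma det_cycle_mat: "det cycle_mat \<noteq> 0"
proof
  assume "det cycle_mat = 0"
  moreover have c: "cycle_mat \<in> carrier_mat (2 * n + 1) (2 * n + 1)"
    by (simp add: cycle_mat_def)
  ultimately have "det (transpose_mat cycle_mat) = 0"
    by (simp add: det_transpose)
  then obtain x where x: "x \<in> carrier_vec (2 * n + 1)" "x \<noteq> 0\<^sub>v (2 * n + 1)"
      "transpose_mat cycle_mat *\<^sub>v x = 0\<^sub>v (2 * n + 1)"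
    using det_0_iff_vec_prod_zero[of "transpose_mat cycle_mat" "2 * n + 1"] c by auto
  have eq: "(\<Sum>m = 0..<2 * n + 1. cycle_mat $$ (m, i) * x $ m) = 0" if "i < 2 * n + 1" for i
  proof -
    have "(transpose_mat cycle_mat *\<^sub>v x) $ i = 0"
      using that by (simp only: x(3) index_zero_vec)
    then show ?thesis
      using that c x(1) by (simp add: scalar_prod_def cycle_mat_def)
  qed
  define g where "g = (\<lambda>\<epsilon>. x $ f_inv \<epsilon>)"
  have g: "g (f m) = x $ m" if "m < 2 * n + 1" for m
    using that by (simp add: g_def f_inv_f)
  have "g \<epsilon> = 0" if "\<epsilon> \<in> edges k" for \<epsilon>
  proof (rule closed_zero_on_tree[OF _ _ that])
    fix \<epsilon> assume "\<epsilon> \<in> tree k"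
    then have lt: "f_inv \<epsilon> < n + 1" by (rule f_inv_tree)
    have "(\<Sum>m = 0..<2 * n + 1. cycle_mat $$ (m, f_inv \<epsilon>) * x $ m) =
        (\<Sum>m = 0..<2 * n + 1. if m = f_inv \<epsilon> then x $ m else 0)"
      by (rule sum.cong) (use lt in \<open>auto simp: cycle_mat_def\<close>)
    also have "\<dots> = x $ f_inv \<epsilon>"
      using lt by (subst sum.delta) auto
    finally show "g \<epsilon> = 0"
      using eq[of "f_inv \<epsilon>"] lt by (simp add: g_def)
  next
    fix w assume "w \<in> faces k"
    then obtain m where m: "m < n" "w = white k m" by (rule white_surj)
    have "(\<Sum>\<epsilon> \<in> edges k. g \<epsilon> * circulation \<epsilon> w) = (\<Sum>l = 0..<2 * n + 1. g (f l) * circulation (f l) w)"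
      by (rule sum_f[symmetric])
    also have "\<dots> = (\<Sum>l = 0..<2 * n + 1. cycle_mat $$ (l, n + 1 + m) * x $ l)"
      by (rule sum.cong) (use m in \<open>auto simp: cycle_mat_def g\<close>)
    finally show "(\<Sum>\<epsilon> \<in> edges k. g \<epsilon> * circulation \<epsilon> w) = 0"
      using eq[of "n + 1 + m"] m by simp
  qed
  then have "x = 0\<^sub>v (2 * n + 1)"
    using x(1) f_in g by (intro eq_vecI) (auto simp del: mult_Suc_right)
  with x(2) show False by contradiction
qed

text \<open>A kernel vector, extended by 0 off the tree, is conserved at the inner vertices and has
  total 0 at \<open>Btilde\<close>, hence is zero by \<open>flow_zero_off_tree\<close>.\<close>

lemma det_tree_mat: "det tree_mat \<noteq> 0"
proof
  assume "det tree_mat = 0"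
  moreover have c: "tree_mat \<in> carrier_mat (n + 1) (n + 1)"
    by (simp add: tree_mat_def)
  ultimately obtain x where x: "x \<in> carrier_vec (n + 1)" "x \<noteq> 0\<^sub>v (n + 1)" "tree_mat *\<^sub>v x = 0\<^sub>v (n + 1)"
    using det_0_iff_vec_prod_zero[OF c] by auto
  define g where "g = (\<lambda>\<epsilon>. if \<epsilon> \<in> tree k then x $ f_inv \<epsilon> else 0)"
  have g: "g (f m) = (if m < n + 1 then x $ m else 0)" if "m < 2 * n + 1" for m
    using that f_in_tree[of m] f_notin_tree[of m] by (auto simp: g_def f_inv_f)
  have eq: "(\<Sum>\<epsilon> \<in> edges k. h \<epsilon> * g \<epsilon>) = 0"
    if "i < n + 1" and h: "\<And>c. c < n + 1 \<Longrightarrow> tree_mat $$ (i, c) = h (f c)" for i h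
  proof -
    have "(\<Sum>\<epsilon> \<in> edges k. h \<epsilon> * g \<epsilon>) = (\<Sum>m = 0..<2 * n + 1. h (f m) * g (f m))"
      by (rule sum_f[symmetric])
    also have "\<dots> = (\<Sum>m = 0..<n + 1. h (f m) * g (f m))"
      by (rule sum.mono_neutral_right) (auto simp: g)
    also have "\<dots> = (\<Sum>m = 0..<n + 1. tree_mat $$ (i, m) * x $ m)"
      by (rule sum.cong) (auto simp: g h)
    also have "\<dots> = (tree_mat *\<^sub>v x) $ i"
      using that(1) x(1) by (simp add: scalar_prod_def tree_mat_def)
    also have "\<dots> = 0"
      using that(1) by (simp only: x(3) index_zero_vec)
    finally show ?thesis .
  qed
  have "g \<epsilon> = 0" if "\<epsilon> \<in> edges k" for \<epsilon>
  proof (rule flow_zero_off_tree[OF _ _ _ that])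
    show "g \<epsilon> = 0" if "\<epsilon> \<in> edges k - tree k" for \<epsilon>
      using that by (simp add: g_def)
    show "(\<Sum>\<epsilon> \<in> edges k. last_column k \<epsilon> * g \<epsilon>) = 0"
      by (rule eq[of 0]) (simp_all add: tree_mat_def flow_mat_def)
    fix b assume "b \<in> inner_blacks k"
    then obtain m where m: "m < n" "b = black k m" by (rule black_surj)
    show "(\<Sum>\<epsilon> \<in> edges k. C_mat k (\<lambda>_. 1) \<epsilon> b * g \<epsilon>) = 0"
      by (rule eq[of "m + 1"]) (use m in \<open>simp_all add: tree_mat_def flow_mat_def\<close>)
  qed
  then have "x $ m = 0" if "m < n + 1" for m
    using that f_in[of m] g[of m] by simp
  then have "x = 0\<^sub>v (n + 1)"
    using x(1) by (intro eq_vecI) auto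
  with x(2) show False by contradiction
qed

text \<open>The first \<open>n + 1\<close> columns of \<open>cycle_mat\<close> copy those of
  \<open>flow_mat\<close>, and the others apply the rows to face boundaries. This annihilates the
  weight-free rows and yields face weights in the remaining ones, so the product is block lower
  triangular.\<close>

lemma det_flow_mat:
  "det (flow_mat (last_column k) (\<lambda>_. 1) a) * det cycle_mat = det tree_mat * det (kasteleyn_mat k a)"
proof -
  let ?F = "flow_mat (last_column k) (\<lambda>_. 1) a"
  let ?A3 = "mat n (n + 1) (\<lambda>(i, c). ?F $$ (n + 1 + i, c))"
  have K: "kasteleyn_mat k a \<in> carrier_mat n n"
    by (simp add: kasteleyn_mat_def n_def)
  have cyc: "cycle_mat \<in> carrier_mat (2 * n + 1) (2 * n + 1)"
    by (simp add: cycle_mat_def)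
  have entry: "(?F * cycle_mat) $$ (i, c) = (\<Sum>m = 0..<2 * n + 1. ?F $$ (i, m) * cycle_mat $$ (m, c))"
    if "i < 2 * n + 1" "c < 2 * n + 1" for i c
    using that cyc by (simp add: scalar_prod_def flow_mat_def cycle_mat_def)
  have left: "(?F * cycle_mat) $$ (i, c) = ?F $$ (i, c)" if "i < 2 * n + 1" "c < n + 1" for i c
  proof -
    have "(\<Sum>m = 0..<2 * n + 1. ?F $$ (i, m) * cycle_mat $$ (m, c)) =
        (\<Sum>m = 0..<2 * n + 1. if m = c then ?F $$ (i, m) else 0)"
      by (rule sum.cong) (use that in \<open>auto simp: cycle_mat_def\<close>)
    also have "\<dots> = ?F $$ (i, c)"
      using that by (subst sum.delta) auto
    finally show ?thesis using entry[of i c] that by simp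
  qed
  have right: "(?F * cycle_mat) $$ (i, n + 1 + c) = (\<Sum>\<epsilon> \<in> edges k. h \<epsilon> * circulation \<epsilon> (white k c))"
    if "i < 2 * n + 1" "c < n" and "\<And>m. m < 2 * n + 1 \<Longrightarrow> ?F $$ (i, m) = h (f m)" for i c h
  proof -
    have "(\<Sum>m = 0..<2 * n + 1. ?F $$ (i, m) * cycle_mat $$ (m, n + 1 + c)) =
        (\<Sum>m = 0..<2 * n + 1. h (f m) * circulation (f m) (white k c))"
      by (rule sum.cong) (use that in \<open>auto simp: cycle_mat_def\<close>)
    then show ?thesis using entry[of i "n + 1 + c"] that sum_f[of "\<lambda>\<epsilon>. h \<epsilon> * circulation \<epsilon> (white k c)"] by simp
  qed
  have "?F * cycle_mat = four_block_mat tree_mat (0\<^sub>m (n + 1) n) ?A3 (transpose_mat (kasteleyn_mat k a))"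
    (is "_ = ?R")
  proof (rule eq_matI)
    fix i c assume "i < dim_row ?R" "c < dim_col ?R"
    then have ic: "i < 2 * n + 1" "c < 2 * n + 1"
      using K by (auto simp: tree_mat_def)
    show "(?F * cycle_mat) $$ (i, c) = ?R $$ (i, c)"
    proof (cases "c < n + 1")
      case True
      then show ?thesis
        using ic K by (simp add: left[OF ic(1) True] tree_mat_def) (simp add: flow_mat_def)
    next
      case False
      define d where "d = c - (n + 1)"
      have d: "c = n + 1 + d" "d < n"
        using ic False by (auto simp: d_def)
      have w: "white k d \<in> faces k" by (rule white_in[OF d(2)])
      consider "i = 0" | "0 < i" "i < n + 1" | "n + 1 \<le> i"
        by linarith
      then show ?thesis
      proof cases
        case 1
        have "(?F * cycle_mat) $$ (i, n + 1 + d) = 0"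
          by (subst right[where h = "last_column k"])
            (use 1 d w in \<open>simp_all add: flow_mat_def sum_last_column_circulation\<close>)
        then show ?thesis using 1 d K by (simp add: tree_mat_def)
      next
        case 2
        \<comment> \<open>For constant weights the previous and the next edge cancel.\<close>
        have "face_weight k (\<lambda>_. 1) w b = 0" for w b by (simp add: face_weight_def)
        moreover have "black k (i - 1) \<in> inner_blacks k" using 2 by (intro black_in) auto
        ultimately have "(?F * cycle_mat) $$ (i, n + 1 + d) = 0"
          by (subst right[where h = "\<lambda>\<epsilon>. C_mat k (\<lambda>_. 1) \<epsilon> (black k (i - 1))"])
            (use 2 ic d w in \<open>simp_all add: flow_mat_def sum_C_mat_circulation\<close>)
        then show ?thesis using 2 d K by (simp add: tree_mat_def)
      next
        case 3
        have "black k (i - (n + 1)) \<in> inner_blacks k" using 3 ic by (intro black_in) auto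
        then have "(?F * cycle_mat) $$ (i, n + 1 + d) = face_weight k a (white k d) (black k (i - (n + 1)))"
          by (subst right[where h = "\<lambda>\<epsilon>. C_mat k a \<epsilon> (black k (i - (n + 1)))"])
            (use 3 ic d w in \<open>simp_all add: flow_mat_def sum_C_mat_circulation\<close>)
        then show ?thesis using 3 d ic K by (simp add: tree_mat_def kasteleyn_mat_def n_def)
      qed
    qed
  qed (use K in \<open>auto simp: tree_mat_def flow_mat_def cycle_mat_def\<close>)
  then have "det (?F * cycle_mat) = det tree_mat * det (transpose_mat (kasteleyn_mat k a))"
    using K by (simp only:) (rule det_four_block_mat_upper_right_zero, auto simp: tree_mat_def)
  then show ?thesis
    using det_mult[OF flow_mat_carrier cyc] det_transpose[OF K] by simp
qed

text \<open>Exchanging two blocks of \<open>n\<close> rows costs \<open>(- 1) ^ (n * n)\<close>, and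
  \<open>n = k * (k + 1)\<close> is even.\<close>

lemma det_flow_mat_swap: "det (flow_mat r a b) = det (flow_mat r b a)"
proof -
  have "even n" by (simp add: n_def)
  have "det (flow_mat r a b) = (- 1) ^ (n * n) * det (mat (2 * n + 1) (2 * n + 1)
      (\<lambda>(i, j). flow_mat r a b $$ (if i < 1 then i else if i < 1 + n then i + n else i - n, j)))"
    by (rule det_swap_final_rows[OF flow_mat_carrier]) simp
  also have "mat (2 * n + 1) (2 * n + 1)
      (\<lambda>(i, j). flow_mat r a b $$ (if i < 1 then i else if i < 1 + n then i + n else i - n, j)) = flow_mat r b a"
    by (rule eq_matI) (auto simp: flow_mat_def)
  finally show ?thesis using \<open>even n\<close> by simp
qed

text \<open>Column \<open>m\<close> on the left is \<open>a (f m)\<close> times column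
  \<open>m\<close> on the right, as multiplying by \<open>a\<close> turns inverse weights into 1 and
  1 into \<open>a\<close>. This is how the inverted weights of the ratio come in.\<close>

lemma det_flow_mat_scale:
  assumes "\<And>\<epsilon>. \<epsilon> \<in> edges k \<Longrightarrow> a \<epsilon> \<noteq> 0"
  shows "det (flow_mat (\<lambda>\<epsilon>. a \<epsilon> * r \<epsilon>) (\<lambda>_. 1) a) =
    (\<Prod>\<epsilon> \<in> edges k. a \<epsilon>) * det (flow_mat r (\<lambda>\<epsilon>. inverse (a \<epsilon>)) (\<lambda>_. 1))"
proof -
  let ?N = "2 * n + 1"
  let ?A = "flow_mat (\<lambda>\<epsilon>. a \<epsilon> * r \<epsilon>) (\<lambda>_. 1) a" and ?B = "flow_mat r (\<lambda>\<epsilon>. inverse (a \<epsilon>)) (\<lambda>_. 1)"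
  have entry: "?A $$ (i, m) = a (f m) * ?B $$ (i, m)" if "i < ?N" "m < ?N" for i m
    using that assms[OF f_in[OF that(2)]] by (simp add: flow_mat_def C_mat_def)
  have "(\<Prod>i = 0..<?N. ?A $$ (i, p i)) = (\<Prod>\<epsilon> \<in> edges k. a \<epsilon>) * (\<Prod>i = 0..<?N. ?B $$ (i, p i))"
    if p: "p permutes {0..<?N}" for p
  proof -
    have "(\<Prod>i = 0..<?N. ?A $$ (i, p i)) = (\<Prod>i = 0..<?N. a (f (p i)) * ?B $$ (i, p i))"
    proof (rule prod.cong)
      fix i assume "i \<in> {0..<?N}"
      then show "?A $$ (i, p i) = a (f (p i)) * ?B $$ (i, p i)"
        using permutes_in_image[OF p, of i] by (intro entry) simp_all
    qed simp
    also have "\<dots> = (\<Prod>i = 0..<?N. a (f (p i))) * (\<Prod>i = 0..<?N. ?B $$ (i, p i))"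
      by (rule prod.distrib)
    also have "(\<Prod>i = 0..<?N. a (f (p i))) = (\<Prod>i = 0..<?N. a (f i))"
      using prod.permute[OF p, of "\<lambda>i. a (f i)"] by (simp add: comp_def)
    also have "\<dots> = (\<Prod>\<epsilon> \<in> edges k. a \<epsilon>)"
      by (rule prod.reindex_bij_betw[OF f])
    finally show ?thesis .
  qed
  then show ?thesis
    unfolding det_def'[OF flow_mat_carrier] sum_distrib_left
    by (intro sum.cong) (simp_all only: mem_Collect_eq mult.left_commute)
qed

text \<open>Each Leibniz term contains exactly one entry of row 0.\<close>

lemma det_flow_mat_linear:
  "det (flow_mat (\<lambda>\<epsilon>. x * r \<epsilon> - y * s \<epsilon>) a b) = x * det (flow_mat r a b) - y * det (flow_mat s a b)"
proof -
  \<comment> \<open>The zero function only fills row 0, which \<open>?R\<close> never reads.\<close>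
  let ?R = "\<lambda>p. \<Prod>i = 0..<2 * n. flow_mat (\<lambda>_. 0) a b $$ (Suc i, p (Suc i))"
  have "(\<Prod>i = 0..<2 * n + 1. flow_mat r a b $$ (i, p i)) = r (f (p 0)) * ?R p"
    if p: "p permutes {0..<2 * n + 1}" for p and r :: "bedge \<Rightarrow> complex"
  proof -
    have lt: "p i < 2 * n + 1" if "i < 2 * n + 1" for i
      using permutes_in_image[OF p, of i] that by simp
    have "(\<Prod>i = 0..<2 * n + 1. flow_mat r a b $$ (i, p i)) =
        flow_mat r a b $$ (0, p 0) * (\<Prod>i = 0..<2 * n. flow_mat r a b $$ (Suc i, p (Suc i)))"
      by (simp add: prod.atLeast0_lessThan_Suc_shift del: prod.op_ivl_Suc)
    also have "(\<Prod>i = 0..<2 * n. flow_mat r a b $$ (Suc i, p (Suc i))) = ?R p"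
      by (rule prod.cong) (use lt in \<open>auto simp: flow_mat_def\<close>)
    finally show ?thesis
      using lt[of 0] by (simp add: flow_mat_def)
  qed
  then have "det (flow_mat r a b) = (\<Sum>p | p permutes {0..<2 * n + 1}. signof p * (r (f (p 0)) * ?R p))"
    for r :: "bedge \<Rightarrow> complex"
    unfolding det_def'[OF flow_mat_carrier] by (intro sum.cong) (simp_all only: mem_Collect_eq)
  then show ?thesis
    by (simp add: sum_distrib_left sum_subtractf algebra_simps)
qed

lemma det_flow_mat_kernel:
  assumes "\<exists>\<epsilon> \<in> edges k. v \<epsilon> \<noteq> 0"
    and "(\<Sum>\<epsilon> \<in> edges k. r \<epsilon> * v \<epsilon>) = 0"
    and "\<And>c. c \<in> inner_blacks k \<Longrightarrow> (\<Sum>\<epsilon> \<in> edges k. C_mat k a \<epsilon> c * v \<epsilon>) = 0"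
    and "\<And>c. c \<in> inner_blacks k \<Longrightarrow> (\<Sum>\<epsilon> \<in> edges k. C_mat k b \<epsilon> c * v \<epsilon>) = 0"
  shows "det (flow_mat r a b) = 0"
proof -
  let ?v = "vec (2 * n + 1) (\<lambda>m. v (f m))"
  have row: "(flow_mat r a b *\<^sub>v ?v) $ i = (\<Sum>\<epsilon> \<in> edges k. h \<epsilon> * v \<epsilon>)"
    if "i < 2 * n + 1" "\<And>m. m < 2 * n + 1 \<Longrightarrow> flow_mat r a b $$ (i, m) = h (f m)" for i h
  proof -
    have "(flow_mat r a b *\<^sub>v ?v) $ i = (\<Sum>m = 0..<2 * n + 1. flow_mat r a b $$ (i, m) * v (f m))"
      using that(1) by (simp add: scalar_prod_def flow_mat_def)
    also have "\<dots> = (\<Sum>m = 0..<2 * n + 1. h (f m) * v (f m))"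
      by (rule sum.cong) (auto simp: that(2))
    also have "\<dots> = (\<Sum>\<epsilon> \<in> edges k. h \<epsilon> * v \<epsilon>)"
      by (rule sum_f)
    finally show ?thesis .
  qed
  have "flow_mat r a b *\<^sub>v ?v = 0\<^sub>v (2 * n + 1)"
  proof (rule eq_vecI)
    fix i assume "i < dim_vec (0\<^sub>v (2 * n + 1) :: complex vec)"
    then have i: "i < 2 * n + 1" by simp
    consider "i = 0" | "0 < i" "i < n + 1" | "n + 1 \<le> i" by linarith
    then have "(flow_mat r a b *\<^sub>v ?v) $ i = 0"
    proof cases
      case 1
      then show ?thesis by (subst row[where h = r]) (simp_all add: flow_mat_def assms(2))
    next
      case 2
      then have "black k (i - 1) \<in> inner_blacks k" by (intro black_in) auto
      then show ?thesis
        using 2 i assms(3)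
        by (subst row[where h = "\<lambda>\<epsilon>. C_mat k a \<epsilon> (black k (i - 1))"]) (simp_all add: flow_mat_def)
    next
      case 3
      then have "black k (i - (n + 1)) \<in> inner_blacks k" using i by (intro black_in) auto
      then show ?thesis
        using 3 i assms(4)
        by (subst row[where h = "\<lambda>\<epsilon>. C_mat k b \<epsilon> (black k (i - (n + 1)))"]) (simp_all add: flow_mat_def)
    qed
    then show "(flow_mat r a b *\<^sub>v ?v) $ i = 0\<^sub>v (2 * n + 1) $ i"
      using i by simp
  qed (simp add: flow_mat_def)
  moreover have "?v \<noteq> 0\<^sub>v (2 * n + 1)"
  proof
    assume "?v = 0\<^sub>v (2 * n + 1)"
    then have "v (f m) = 0" if "m < 2 * n + 1" for m
      using that by (metis index_vec index_zero_vec(1))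
    then have "v \<epsilon> = 0" if "\<epsilon> \<in> edges k" for \<epsilon>
      using that unfolding bij_betw_imp_surj_on[OF f, symmetric] by auto
    then show False using assms(1) by blast
  qed
  ultimately show ?thesis
    using det_0_iff_vec_prod_zero[OF flow_mat_carrier, of r a b] vec_carrier by blast
qed

lemma ratio_of_kernel_vector:
  assumes a: "\<And>\<epsilon>. \<epsilon> \<in> edges k \<Longrightarrow> a \<epsilon> \<noteq> 0"
    and K: "det (kasteleyn_mat k a) \<noteq> 0"
    and v: "\<exists>\<epsilon> \<in> edges k. v \<epsilon> \<noteq> 0"
    and flow: "\<And>c. c \<in> inner_blacks k \<Longrightarrow> (\<Sum>\<epsilon> \<in> edges k. C_mat k (\<lambda>_. 1) \<epsilon> c * v \<epsilon>) = 0"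
      "\<And>c. c \<in> inner_blacks k \<Longrightarrow> (\<Sum>\<epsilon> \<in> edges k. C_mat k a \<epsilon> c * v \<epsilon>) = 0"
  defines "V \<equiv> \<Sum>j = 0..k. v (Hor k j)" and "U \<equiv> \<Sum>j = 0..k. a (Hor k j) * v (Hor k j)"
  shows "V \<noteq> 0"
    and "V * ((\<Prod>\<epsilon> \<in> edges k. a \<epsilon>) * det (kasteleyn_mat k (\<lambda>\<epsilon>. inverse (a \<epsilon>)))) = U * det (kasteleyn_mat k a)"
proof -
  let ?t = "last_column k"
  \<comment> \<open>This factor does not involve the weights, so it is the same for \<open>a\<close>
    and its inverse.\<close>
  define \<gamma> where "\<gamma> = det tree_mat / det cycle_mat"
  have \<gamma>: "\<gamma> \<noteq> 0" "det (flow_mat ?t (\<lambda>_. 1) a) = \<gamma> * det (kasteleyn_mat k a)" for a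
    using det_cycle_mat det_tree_mat det_flow_mat[of a] by (auto simp: \<gamma>_def field_simps)
  have sums: "(\<Sum>\<epsilon> \<in> edges k. ?t \<epsilon> * v \<epsilon>) = V" "(\<Sum>\<epsilon> \<in> edges k. (a \<epsilon> * ?t \<epsilon>) * v \<epsilon>) = U"
    using sum_last_column[of k v] sum_last_column[of k "\<lambda>\<epsilon>. a \<epsilon> * v \<epsilon>"]
    by (simp_all add: V_def U_def ac_simps)
  \<comment> \<open>If \<open>V\<close> were 0, \<open>v\<close> would be orthogonal to
    \<open>t\<close> as well as to the columns of \<open>D\<close>, contradicting the nonzero
    determinant.\<close>
  show "V \<noteq> 0"
  proof
    assume "V = 0"
    then have "det (flow_mat ?t (\<lambda>_. 1) a) = 0"
      using sums(1) by (intro det_flow_mat_kernel[OF v _ flow]) simp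
    then show False using \<gamma> K by simp
  qed
  have "(\<Sum>\<epsilon> \<in> edges k. (V * (a \<epsilon> * ?t \<epsilon>) - U * ?t \<epsilon>) * v \<epsilon>) =
      V * (\<Sum>\<epsilon> \<in> edges k. (a \<epsilon> * ?t \<epsilon>) * v \<epsilon>) - U * (\<Sum>\<epsilon> \<in> edges k. ?t \<epsilon> * v \<epsilon>)"
    by (simp add: sum_distrib_left sum_subtractf algebra_simps)
  also have "\<dots> = 0" by (simp add: sums)
  finally have "det (flow_mat (\<lambda>\<epsilon>. V * (a \<epsilon> * ?t \<epsilon>) - U * ?t \<epsilon>) (\<lambda>_. 1) a) = 0"
    by (intro det_flow_mat_kernel[OF v _ flow])
  then have "V * det (flow_mat (\<lambda>\<epsilon>. a \<epsilon> * ?t \<epsilon>) (\<lambda>_. 1) a) = U * det (flow_mat ?t (\<lambda>_. 1) a)"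
    by (simp add: det_flow_mat_linear)
  \<comment> \<open>On the left, scaling replaces \<open>a\<close> by its inverse and swapping the
    blocks restores the order for which \<gamma> was computed.\<close>
  then have "\<gamma> * (V * ((\<Prod>\<epsilon> \<in> edges k. a \<epsilon>) * det (kasteleyn_mat k (\<lambda>\<epsilon>. inverse (a \<epsilon>))))) =
      \<gamma> * (U * det (kasteleyn_mat k a))"
    by (simp add: det_flow_mat_scale[OF a] det_flow_mat_swap[of ?t _ "\<lambda>_. 1"] \<gamma>(2) ac_simps)
  then show "V * ((\<Prod>\<epsilon> \<in> edges k. a \<epsilon>) * det (kasteleyn_mat k (\<lambda>\<epsilon>. inverse (a \<epsilon>)))) = U * det (kasteleyn_mat k a)"
    using \<gamma>(1) by simp
qed

end

lemma edge_enumeration_exists: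
  assumes "k \<ge> 1"
  shows "\<exists>f. edge_enumeration k f"
proof -
  define n where "n = k * (k + 1)"
  have fin: "finite (tree k)"
    using tree_subset finite_edges by (rule finite_subset)
  have card: "card (tree k) = n + 1" "card (edges k - tree k) = n"
    using card_tree[of k] card_edges[of k] fin tree_subset[of k]
    by (simp_all add: n_def card_Diff_subset power2_eq_square)
  obtain g where g: "bij_betw g {0..<n + 1} (tree k)"
    using ex_bij_betw_nat_finite[OF fin] card by auto
  obtain h where h: "bij_betw h {0..<n} (edges k - tree k)"
    using ex_bij_betw_nat_finite[of "edges k - tree k"] finite_edges card by auto
  define f where "f = (\<lambda>m. if m < n + 1 then g m else h (m - (n + 1)))"
  have f1: "bij_betw f {0..<n + 1} (tree k)"
    using g by (rule bij_betw_cong[THEN iffD1, rotated]) (simp add: f_def)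
  have "bij_betw (\<lambda>m. m - (n + 1)) {n + 1..<2 * n + 1} {0..<n}"
    by (rule bij_betwI[where g = "\<lambda>m. m + (n + 1)"]) auto
  from bij_betw_trans[OF this h] have f2: "bij_betw f {n + 1..<2 * n + 1} (edges k - tree k)"
    by (rule bij_betw_cong[THEN iffD1, rotated]) (simp add: f_def)
  have "bij_betw f ({0..<n + 1} \<union> {n + 1..<2 * n + 1}) (tree k \<union> (edges k - tree k))"
    by (rule bij_betw_combine[OF f1 f2]) auto
  moreover have "{0..<n + 1} \<union> {n + 1..<2 * n + 1} = {0..<2 * n + 1}" by auto
  moreover have "tree k \<union> (edges k - tree k) = edges k" using tree_subset by blast
  ultimately have "edge_enumeration k f"
    using f1 assms by unfold_locales (simp_all add: n_def)
  then show ?thesis by blast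
qed

theorem theorem5p3:
  fixes k :: nat
    and a v :: "bedge \<Rightarrow> complex"
    and \<phi> :: "avertex \<times> avertex \<Rightarrow> int"
  assumes "k \<ge> 1"
    and "\<forall>f \<in> edges k. a f \<noteq> 0"
    and "kasteleyn_orientation k \<phi>"
    and "partition_function k a \<phi> \<noteq> 0"
    and "\<exists>\<epsilon> \<in> edges k. v \<epsilon> \<noteq> 0"
    and "\<forall>c \<in> inner_blacks k <+> inner_blacks k. (\<Sum>\<epsilon> \<in> edges k. D_mat k a \<epsilon> c * v \<epsilon>) = 0"
  shows "(\<Sum>j=0..k. v (Hor k j)) \<noteq> 0 \<and>
         ratio_function k a \<phi> =
           (\<Sum>j=0..k. a (Hor k j) * v (Hor k j)) / (\<Sum>j=0..k. v (Hor k j))"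
proof -
  obtain f where "edge_enumeration k f"
    using edge_enumeration_exists[OF assms(1)] by blast
  then interpret edge_enumeration k "k * (k + 1)" f
    by simp
  \<comment> \<open>One constant \<open>c\<close> serves both the weights and their inverses, so it
    cancels in the quotient.\<close>
  obtain c where c: "\<And>a. partition_function k a \<phi> = c * det (kasteleyn_mat k a)"
    using partition_function_eq_det[OF assms(1,3)] by blast
  have "c \<noteq> 0" and K: "det (kasteleyn_mat k a) \<noteq> 0"
    using assms(4) by (auto simp: c)
  have flow: "(\<Sum>\<epsilon> \<in> edges k. C_mat k (\<lambda>_. 1) \<epsilon> c * v \<epsilon>) = 0" "(\<Sum>\<epsilon> \<in> edges k. C_mat k a \<epsilon> c * v \<epsilon>) = 0"
    if "c \<in> inner_blacks k" for c
    using bspec[OF assms(6), of "Inl c"] bspec[OF assms(6), of "Inr c"] that by auto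
  note ratio = ratio_of_kernel_vector[OF _ K assms(5) flow]
  have "(\<Sum>j=0..k. v (Hor k j)) \<noteq> 0"
    by (rule ratio(1)) (use assms(2) in auto)
  moreover have "(\<Sum>j=0..k. v (Hor k j)) *
      ((\<Prod>\<epsilon> \<in> edges k. a \<epsilon>) * det (kasteleyn_mat k (\<lambda>\<epsilon>. inverse (a \<epsilon>)))) =
      (\<Sum>j=0..k. a (Hor k j) * v (Hor k j)) * det (kasteleyn_mat k a)"
    by (rule ratio(2)) (use assms(2) in auto)
  ultimately show ?thesis
    using \<open>c \<noteq> 0\<close> K by (simp add: ratio_function_def c field_simps)
qed

end
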